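(* Let $n\geq 2$. Two $n$-component virtual links $L$ and $L'$ are $v\Delta$-equivalent to each other if and only if $p_i(L)=p_i(L')$ holds for every $i=1,\dots,n$.
   Context: A virtual link diagram is a generic immersion of finitely many oriented circles in the plane in which each double point is either a real crossing (with over/under information) or a virtual crossing. Virtual links are equivalence classes of such diagrams under generalized Reidemeister moves (the classical Reidemeister moves I, II, III together with the virtual moves involving virtual crossings); equivalently, they are equivalence classes of Gauss diagrams under the Reidemeister moves I, II, III on Gauss diagrams. In a Gauss diagram, each real crossing is recorded as a signed chord oriented from the over-crossing point (initial endpoint) to the under-crossing point (terminal endpoint). The components of a virtual link are ordered, $L=K_1\cup\dots\cup K_n$, with corresponding Gauss diagram $G=G_1\cup\dots\cup G_n$, and equivalences respect the ordering. A virtualized $\Delta$-move ($v\Delta$) is the following local deformation of a virtual link diagram, performed in either direction. In a disk, three strands (with arbitrary orientations, belonging to arbitrary components) pairwise cross exactly once, forming a triangle, and all three crossings are real and alternating, i.e. each strand passes over one of the other two strands and under the other one; the move replaces the three real crossings by three virtual crossings. Both alternating patterns (mirror images of each other) are allowed. In terms of Gauss diagrams, the move deletes or inserts three chords of the following form: there are three disjoint arcs $s_1,s_2,s_3$ of the underlying circles, the three chords run from $s_1$ to $s_2$, from $s_2$ to $s_3$ and from $s_3$ to $s_1$, and the $s_i$ contain no other chord endpoints; setting $\eta_i=+1$ if along the oriented arc $s_i$ the terminal endpoint precedes the initial endpoint and $\eta_i=-1$ otherwise, the sign of the chord joining $s_i$ and $s_j$ is $\delta\eta_i\eta_j$ with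 a common $\delta\in\{+1,-1\}$ for all three chords (the two values of $\delta$ correspond to the two alternating patterns). Two virtual links are $v\Delta$-equivalent if their diagrams are related by a finite sequence of virtualized $\Delta$-moves and generalized Reidemeister moves. A chord is a self-chord if both its endpoints lie on the same circle $G_i$, and a nonself-chord otherwise. The $i$th parity $p_i(L)\in\{0,1\}$ is the parity of the number of endpoints of nonself-chords lying on $G_i$, for any Gauss diagram $G=G_1\cup\dots\cup G_n$ of $L$; it does not depend on the choice of $G$. *)

theory Defs
  imports Main
begin

section \<open>Gauss diagrams\<close>

text \<open>
  A chord is recorded by its two endpoints: \<open>Over c s\<close> is the initial (over-crossing) endpoint and
  \<open>Under c s\<close> the terminal (under-crossing) endpoint of the chord with label \<open>c\<close> and sign \<open>s\<close>.
\<close>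

datatype 'c endpoint = Over (chord: 'c) (chord_sign: int) | Under (chord: 'c) (chord_sign: int)

text \<open>
  A Gauss diagram on \<open>n\<close> ordered oriented circles is a list of \<open>n\<close> words; the word at position \<open>i\<close>
  (positions start at 0) lists the endpoints met when traversing circle \<open>i\<close> once along its
  orientation, from some base point.  The base points and the chord labels are auxiliary: see
  \<open>same_diagram\<close> below.
\<close>

type_synonym gauss_word = "nat endpoint list"
type_synonym gauss_code = "gauss_word list"

definition gauss_diagram :: "nat \<Rightarrow> gauss_code \<Rightarrow> bool" where
  "gauss_diagram n G \<longleftrightarrow>
     length G = n \<and> distinct (concat G) \<and>
     (\<forall>e\<in>set (concat G). \<exists>s\<in>{1, -1}.
        {x \<in> set (concat G). chord x = chord e} = {Over (chord e) s, Under (chord e) s})"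

definition same_diagram :: "gauss_code \<Rightarrow> gauss_code \<Rightarrow> bool" where
  "same_diagram G G' \<longleftrightarrow>
     (\<exists>f. inj_on f (chord ` set (concat G)) \<and>
          list_all2 (\<lambda>u v. \<exists>k. v = rotate k (map (map_endpoint f) u)) G G')"


section \<open>Local moves\<close>

text \<open>
  A context is a Gauss code with numbered holes \<open>Inl k\<close>, the arcs involved in a local move.
  Filling replaces hole \<open>k\<close> by the \<open>k\<close>-th of the given words.  As each hole occurs exactly once,
  the arcs are disjoint; they may lie on arbitrary circles, in arbitrary order.  An arc may not
  contain a base point, which is no restriction up to \<open>same_diagram\<close>.
\<close>

type_synonym gauss_context = "(nat + nat endpoint) list list"

definition holes :: "gauss_context \<Rightarrow> nat list" where
  "holes C = map projl (filter isl (concat C))"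

definition fill :: "gauss_context \<Rightarrow> gauss_word list \<Rightarrow> gauss_code" where
  "fill C ws = map (\<lambda>w. concat (map (case_sum (\<lambda>k. ws ! k) (\<lambda>e. [e])) w)) C"

text \<open>
  Validity of both diagrams forces the chords inserted by a move to be distinct from each other
  and from all remaining chords.
\<close>

definition local_move ::
    "(gauss_word list \<Rightarrow> gauss_word list \<Rightarrow> bool) \<Rightarrow> gauss_code \<Rightarrow> gauss_code \<Rightarrow> bool" where
  "local_move P G G' \<longleftrightarrow>
     gauss_diagram (length G) G \<and> gauss_diagram (length G') G' \<and>
     (\<exists>C as bs. P as bs \<and> length as = length bs \<and>
        distinct (holes C) \<and> set (holes C) = {..<length as} \<and>
        G = fill C as \<and> G' = fill C bs)"

text \<open>The word \<open>x y\<close> read along the arc (\<open>\<epsilon> = 1\<close>) or against it (\<open>\<epsilon> = -1\<close>).\<close>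

definition along :: "int \<Rightarrow> nat endpoint \<Rightarrow> nat endpoint \<Rightarrow> gauss_word" where
  "along \<epsilon> x y = (if \<epsilon> = 1 then [x, y] else [y, x])"


section \<open>Reidemeister moves and virtual links\<close>

text \<open>
  Third move: the arcs are the top, middle and bottom strand, in this order, and the chords
  \<open>a\<close>, \<open>b\<close>, \<open>c\<close> are the crossings top/middle, middle/bottom and top/bottom.  The move reverses the
  order of the two endpoints on each arc and keeps the signs.  If the three strands traverse the
  boundary of the triangle coherently, counterclockwise and in the order top, middle, bottom, then
  all \<open>\<epsilon>\<close> equal \<open>1\<close> and the signs of \<open>a\<close>, \<open>b\<close>, \<open>c\<close> are \<open>+\<close>, \<open>+\<close>, \<open>-\<close>; reversing a strand changes
  its \<open>\<epsilon>\<close> and the signs of its two crossings.  Mirror images in the plane have \<open>\<delta> = -1\<close>.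
\<close>

inductive reidemeister_pattern :: "gauss_word list \<Rightarrow> gauss_word list \<Rightarrow> bool" where
  R1: "\<lbrakk>s \<in> {1, -1}; \<epsilon> \<in> {1, -1}\<rbrakk> \<Longrightarrow>
    reidemeister_pattern [[]] [along \<epsilon> (Over c s) (Under c s)]"
| R2: "\<lbrakk>s \<in> {1, -1}; \<epsilon> \<in> {1, -1}\<rbrakk> \<Longrightarrow>
    reidemeister_pattern [[], []]
      [[Over c s, Over d (- s)], along \<epsilon> (Under c s) (Under d (- s))]"
| R3: "\<lbrakk>\<delta> \<in> {1, -1}; \<epsilon>1 \<in> {1, -1}; \<epsilon>2 \<in> {1, -1}; \<epsilon>3 \<in> {1, -1};
    sa = \<delta> * \<epsilon>1 * \<epsilon>2; sb = \<delta> * \<epsilon>2 * \<epsilon>3; sc = - (\<delta> * \<epsilon>3 * \<epsilon>1)\<rbrakk> \<Longrightarrow>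
    reidemeister_pattern
      [along \<epsilon>1 (Over c sc) (Over a sa),
       along \<epsilon>2 (Under a sa) (Over b sb),
       along \<epsilon>3 (Under b sb) (Under c sc)]
      [along (- \<epsilon>1) (Over c sc) (Over a sa),
       along (- \<epsilon>2) (Under a sa) (Over b sb),
       along (- \<epsilon>3) (Under b sb) (Under c sc)]"

definition reidemeister_step :: "gauss_code \<Rightarrow> gauss_code \<Rightarrow> bool" where
  "reidemeister_step G G' \<longleftrightarrow>
     (gauss_diagram (length G) G \<and> same_diagram G G') \<or> local_move reidemeister_pattern G G'"

definition virtual_links :: "nat \<Rightarrow> gauss_code set set" where
  "virtual_links n =
     {G. gauss_diagram n G} //
     {(G, G'). gauss_diagram n G \<and> gauss_diagram n G' \<and> equivclp reidemeister_step G G'}"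


section \<open>The virtualized Delta-move\<close>

inductive vDelta_pattern :: "gauss_word list \<Rightarrow> gauss_word list \<Rightarrow> bool" where
  "\<lbrakk>\<delta> \<in> {1, -1}; \<eta>1 \<in> {1, -1}; \<eta>2 \<in> {1, -1}; \<eta>3 \<in> {1, -1};
    sa = \<delta> * \<eta>1 * \<eta>2; sb = \<delta> * \<eta>2 * \<eta>3; sc = \<delta> * \<eta>3 * \<eta>1\<rbrakk> \<Longrightarrow>
    vDelta_pattern
      [[], [], []]
      [along \<eta>1 (Under c sc) (Over a sa),
       along \<eta>2 (Under a sa) (Over b sb),
       along \<eta>3 (Under b sb) (Over c sc)]"

definition vDelta_step :: "gauss_code \<Rightarrow> gauss_code \<Rightarrow> bool" where
  "vDelta_step G G' \<longleftrightarrow> reidemeister_step G G' \<or> local_move vDelta_pattern G G'"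

definition vDelta_equivalent :: "gauss_code set \<Rightarrow> gauss_code set \<Rightarrow> bool" where
  "vDelta_equivalent L L' \<longleftrightarrow> (\<exists>G\<in>L. \<exists>G'\<in>L'. equivclp vDelta_step G G')"


section \<open>Parities\<close>

definition self_chord :: "gauss_code \<Rightarrow> nat \<Rightarrow> bool" where
  "self_chord G c \<longleftrightarrow> (\<exists>w\<in>set G. \<exists>s. Over c s \<in> set w \<and> Under c s \<in> set w)"

definition diagram_parity :: "gauss_code \<Rightarrow> nat \<Rightarrow> nat" where
  "diagram_parity G i = card {e \<in> set (G ! i). \<not> self_chord G (chord e)} mod 2"

text \<open>
  The common value of \<open>diagram_parity G i\<close> over all diagrams \<open>G\<close> of \<open>L\<close>; it is well defined by
  \<open>link_parity_eq\<close> below.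
\<close>

definition link_parity :: "gauss_code set \<Rightarrow> nat \<Rightarrow> nat" where
  "link_parity L i = the_elem ((\<lambda>G. diagram_parity G i) ` L)"


subsection \<open>Independence of the diagram\<close>

lemma card_eq_split:
  assumes "finite A"
  shows "card A = card {x \<in> A. P x} + card {x \<in> A. \<not> P x}"
proof -
  have "A = {x \<in> A. P x} \<union> {x \<in> A. \<not> P x}" by blast
  moreover have "card ({x \<in> A. P x} \<union> {x \<in> A. \<not> P x}) = card {x \<in> A. P x} + card {x \<in> A. \<not> P x}"
    using assms by (intro card_Un_disjoint) auto
  ultimately show ?thesis by simp
qed

lemma card_self_endpoints_even:
  assumes G: "gauss_diagram n G" and i: "i < n"
  shows "even (card {e \<in> set (G ! i). self_chord G (chord e)})"
proof -
  let ?E = "{e \<in> set (G ! i). self_chord G (chord e)}"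
  let ?A = "{e \<in> ?E. is_Over e}" and ?B = "{e \<in> ?E. \<not> is_Over e}"
  let ?f = "\<lambda>e. Under (chord e) (chord_sign e)" and ?g = "\<lambda>e. Over (chord e) (chord_sign e)"
  have len: "length G = n" and dist: "distinct (concat G)"
    using G by (auto simp: gauss_diagram_def)
  have both: "Over (chord e) (chord_sign e) \<in> ?E \<and> Under (chord e) (chord_sign e) \<in> ?E"
    if e: "e \<in> ?E" for e
  proof -
    have ein: "e \<in> set (concat G)" using e i len by auto
    then obtain s where s: "e = Over (chord e) s \<or> e = Under (chord e) s"
      and uniq: "{x \<in> set (concat G). chord x = chord e} = {Over (chord e) s, Under (chord e) s}"
      using G unfolding gauss_diagram_def by blast
    from e obtain w t where w: "w \<in> set G" "Over (chord e) t \<in> set w" "Under (chord e) t \<in> set w"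
      by (auto simp: self_chord_def)
    then have "Over (chord e) t \<in> {x \<in> set (concat G). chord x = chord e}" by auto
    then have "Over (chord e) t \<in> {Over (chord e) s, Under (chord e) s}" unfolding uniq .
    then have t: "t = s" by simp
    have "e \<in> set w" using s w(2,3) unfolding t by metis
    moreover have "e \<in> set (G ! i)" and Gi: "G ! i \<in> set G" using e i len by auto
    ultimately have wi: "w = G ! i"
      using w(1) dist unfolding distinct_concat_iff by blast
    have sgn: "chord_sign e = s" using s by (cases e) auto
    show ?thesis using w(2,3) e unfolding wi t sgn by simp
  qed
  have "bij_betw ?f ?A ?B"
  proof (rule bij_betw_byWitness[where f' = ?g])
    show "?f ` ?A \<subseteq> ?B"
      using both by auto
    show "?g ` ?B \<subseteq> ?A"
      using both by auto
    show "\<forall>e\<in>?A. ?g (?f e) = e"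
      by (intro ballI, case_tac e) simp_all
    show "\<forall>e\<in>?B. ?f (?g e) = e"
      by (intro ballI, case_tac e) simp_all
  qed
  then have "card ?A = card ?B" by (rule bij_betw_same_card)
  moreover have "card ?E = card ?A + card ?B"
    by (rule card_eq_split) simp
  ultimately show ?thesis by simp
qed

lemma diagram_parity_length:
  assumes G: "gauss_diagram n G" and i: "i < n"
  shows "diagram_parity G i = length (G ! i) mod 2"
proof -
  let ?E = "{e \<in> set (G ! i). self_chord G (chord e)}"
  let ?N = "{e \<in> set (G ! i). \<not> self_chord G (chord e)}"
  have "distinct (G ! i)"
    using G i by (auto simp: gauss_diagram_def distinct_concat_iff)
  then have "length (G ! i) = card (set (G ! i))" by (simp add: distinct_card)
  also have "\<dots> = card ?E + card ?N"
    by (rule card_eq_split) simp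
  finally show ?thesis
    using card_self_endpoints_even[OF G i]
    by (simp add: diagram_parity_def mod2_eq_if)
qed

lemma length_along [simp]: "length (along \<epsilon> x y) = 2"
  by (simp add: along_def)

lemma even_length_concat_map:
  assumes "\<And>x. x \<in> set w \<Longrightarrow> even (length (f x)) \<longleftrightarrow> even (length (g x))"
  shows "even (length (concat (map f w))) \<longleftrightarrow> even (length (concat (map g w)))"
  using assms by (induction w) auto

lemma local_move_parity:
  assumes "local_move P G G'"
    and P: "\<And>as bs. P as bs \<Longrightarrow> list_all2 (\<lambda>u v. even (length u) \<longleftrightarrow> even (length v)) as bs"
    and i: "i < length G"
  shows "length G' = length G \<and> (even (length (G' ! i)) \<longleftrightarrow> even (length (G ! i)))"
proof -
  from assms(1) obtain C as bs where C: "P as bs" "set (holes C) = {..<length as}"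
    "G = fill C as" "G' = fill C bs"
    unfolding local_move_def by blast
  have len: "length C = length G" by (simp add: C fill_def)
  have "even (length (case_sum (\<lambda>k. bs ! k) (\<lambda>e. [e]) x)) \<longleftrightarrow>
        even (length (case_sum (\<lambda>k. as ! k) (\<lambda>e. [e]) x))" if "x \<in> set (C ! i)" for x
  proof (cases x)
    case (Inl k)
    have "C ! i \<in> set C" using i len by simp
    then have "x \<in> set (concat C)" using that unfolding set_concat by blast
    then have "x \<in> set (filter isl (concat C))" using Inl by simp
    then have "projl x \<in> set (holes C)" unfolding holes_def set_map by (rule imageI)
    then have "k \<in> set (holes C)" using Inl by simp
    then show ?thesis using C(2) P[OF C(1)] Inl by (simp add: list_all2_conv_all_nth)
  qed simp
  then have *: "even (length (concat (map (case_sum (\<lambda>k. bs ! k) (\<lambda>e. [e])) (C ! i)))) \<longleftrightarrow>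
    even (length (concat (map (case_sum (\<lambda>k. as ! k) (\<lambda>e. [e])) (C ! i))))"
    by (rule even_length_concat_map)
  have "i < length C" using i len by simp
  then have "G ! i = concat (map (case_sum (\<lambda>k. as ! k) (\<lambda>e. [e])) (C ! i))"
    and "G' ! i = concat (map (case_sum (\<lambda>k. bs ! k) (\<lambda>e. [e])) (C ! i))"
    unfolding C(3,4) fill_def by simp_all
  moreover have "length G' = length G" unfolding C(3,4) fill_def by simp
  ultimately show ?thesis using * by (simp only:)
qed

lemma reidemeister_pattern_parity:
  "reidemeister_pattern as bs \<Longrightarrow> list_all2 (\<lambda>u v. even (length u) \<longleftrightarrow> even (length v)) as bs"
proof (erule reidemeister_pattern.cases, goal_cases)
  case (1 s \<epsilon> c)
  show ?case unfolding 1(1,2) by simp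
next
  case (2 s \<epsilon> c d)
  show ?case unfolding 2(1,2) by simp
next
  case (3 \<delta> \<epsilon>1 \<epsilon>2 \<epsilon>3 sa sb sc c a b)
  show ?case unfolding 3(1,2) by simp
qed

lemma reidemeister_step_parity:
  assumes "reidemeister_step G G'" "i < length G"
  shows "length G' = length G \<and> (even (length (G' ! i)) \<longleftrightarrow> even (length (G ! i)))"
  using assms(1) unfolding reidemeister_step_def
proof (elim disjE conjE)
  assume "same_diagram G G'"
  then obtain f where f: "list_all2 (\<lambda>u v. \<exists>k. v = rotate k (map (map_endpoint f) u)) G G'"
    unfolding same_diagram_def by blast
  then obtain k where "G' ! i = rotate k (map (map_endpoint f) (G ! i))"
    using assms(2) list_all2_nthD by blast
  then show ?thesis using list_all2_lengthD[OF f] by simp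
next
  assume "local_move reidemeister_pattern G G'"
  then show ?thesis
    by (rule local_move_parity[OF _ reidemeister_pattern_parity assms(2)])
qed

lemma reidemeister_step_length:
  assumes "reidemeister_step G G'"
  shows "length G = length G'"
  using assms unfolding reidemeister_step_def
proof (elim disjE conjE)
  assume "same_diagram G G'"
  then show ?thesis unfolding same_diagram_def using list_all2_lengthD by blast
next
  assume "local_move reidemeister_pattern G G'"
  then obtain C as bs where "G = fill C as" "G' = fill C bs"
    unfolding local_move_def by blast
  then show ?thesis by (simp add: fill_def)
qed

lemma reidemeister_equiv_parity:
  assumes "equivclp reidemeister_step G G'" "i < length G"
  shows "length G' = length G \<and> (even (length (G' ! i)) \<longleftrightarrow> even (length (G ! i)))"
  using assms
proof (induction rule: equivclp_induct)
  case base
  then show ?case by simp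
next
  case (step G' G'')
  have G': "length G' = length G" "even (length (G' ! i)) \<longleftrightarrow> even (length (G ! i))"
    using step.IH step.prems by blast+
  from step.hyps(2) show ?case
  proof
    assume "reidemeister_step G' G''"
    from reidemeister_step_parity[OF this, of i] show ?thesis
      using G' step.prems by simp
  next
    assume *: "reidemeister_step G'' G'"
    then have "length G'' = length G'"
      by (rule reidemeister_step_length)
    with reidemeister_step_parity[OF *, of i] show ?thesis
      using G' step.prems by simp
  qed
qed

lemma link_parity_eq:
  assumes "L \<in> virtual_links n" "G \<in> L" "i < n"
  shows "link_parity L i = diagram_parity G i"
proof -
  from assms(1) obtain H where H: "gauss_diagram n H"
    and L: "L = {G. gauss_diagram n G \<and> equivclp reidemeister_step H G}"
    unfolding virtual_links_def quotient_def by blast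
  have "diagram_parity G' i = diagram_parity H i" if "G' \<in> L" for G'
  proof -
    have G': "gauss_diagram n G'" "equivclp reidemeister_step H G'" using that L by auto
    have "even (length (G' ! i)) \<longleftrightarrow> even (length (H ! i))"
      using reidemeister_equiv_parity[OF G'(2)] H assms(3) by (auto simp: gauss_diagram_def)
    then show ?thesis
      using diagram_parity_length[OF G'(1) assms(3)] diagram_parity_length[OF H assms(3)]
      by (simp add: mod2_eq_if)
  qed
  then have "(\<lambda>G. diagram_parity G i) ` L = {diagram_parity G i}"
    using assms(2) by auto
  then show ?thesis by (simp add: link_parity_def)
qed

end

theory Submission
  imports Defs "HOL-Library.Multiset"
begin

text \<open>
  The parities are invariants: every pattern adds an even number of endpoints to each arc, and the
  \<open>i\<close>th parity is the parity of the length of the \<open>i\<close>th word (\<open>vequiv_parity\<close>).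

  For the converse, the virtualized Delta-move turns out to erase all of the structure of a Gauss
  diagram except a weak homological remainder.  Write \<open>p \<rightarrow> q\<close> for a chord from \<open>p\<close> to \<open>q\<close>.
  Insert three chords \<open>p' \<rightarrow> q'\<close>, \<open>q' \<rightarrow> r\<close>, \<open>r \<rightarrow> p'\<close> with \<open>p'\<close>, \<open>q'\<close> right next to \<open>p\<close>, \<open>q\<close> and \<open>r\<close>
  anywhere, in such a way that the second Reidemeister move cancels \<open>p' \<rightarrow> q'\<close> against \<open>p \<rightarrow> q\<close>.
  This replaces \<open>p \<rightarrow> q\<close> by the detour \<open>q \<rightarrow> r\<close>, \<open>r \<rightarrow> p\<close>, and the signs of the two new chords as
  well as the order of their endpoints at \<open>r\<close> can be prescribed (\<open>vequiv_detour\<close>).  Three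
  consequences follow.

  \<^item> If \<open>r\<close> is chosen next to \<open>p\<close>, then \<open>r \<rightarrow> p\<close> is an isolated chord and disappears by the first
    Reidemeister move.  Hence a chord can be reversed, and its sign and label are irrelevant
    (\<open>vequiv_replace_chord\<close>).

  \<^item> Two chords \<open>q \<rightarrow> r\<close>, \<open>r \<rightarrow> p\<close> that are adjacent at \<open>r\<close> can be merged to \<open>p \<rightarrow> q\<close> and split again in
    the other order.  As orientations are irrelevant, any two adjacent endpoints can be exchanged
    (\<open>vequiv_swap_arc\<close>), so each circle only matters as a set of endpoints
    (\<open>vequiv_permute_words\<close>).

  \<^item> What remains is a finite multigraph whose vertices are the circles and whose edges are the
    chords.  Loops can be deleted, parallel edges cancel in pairs, and an edge may be replaced by a
    path of two edges through any vertex (\<open>draw_loop\<close>, \<open>draw_double_edge\<close>, \<open>draw_triangle\<close>).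

  Routing every edge through circle \<open>0\<close> and cancelling yields a star: circle \<open>0\<close> is joined by single
  edges to the circles of a set \<open>T\<close> (\<open>draw_star\<close>).  Circle \<open>i \<noteq> 0\<close> lies in \<open>T\<close> exactly if its
  parity is odd, so the parities determine the star and with it the equivalence class.
\<close>


section \<open>Valid collections of endpoints\<close>

fun opp :: "'c endpoint \<Rightarrow> 'c endpoint" where
  "opp (Over c s) = Under c s"
| "opp (Under c s) = Over c s"

lemma opp_simps [simp]:
  "opp (opp x) = x" "chord (opp x) = chord x" "chord_sign (opp x) = chord_sign x"
  "opp x \<noteq> x" "x \<noteq> opp x"
  by (cases x; simp)+

text \<open>
  The validity condition on Gauss diagrams concerns the collection of all endpoints, not their
  positions.  Splitting it off lets the validity of every intermediate diagram be read off from the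
  chords that it contains.
\<close>

definition paired :: "nat endpoint multiset \<Rightarrow> bool" where
  "paired A \<longleftrightarrow> (\<forall>e. count A e \<le> 1) \<and>
     (\<forall>e\<in>#A. \<exists>s\<in>{1, -1}. {x \<in> set_mset A. chord x = chord e} = {Over (chord e) s, Under (chord e) s})"

lemma gauss_diagram_iff: "gauss_diagram n G \<longleftrightarrow> length G = n \<and> paired (mset (concat G))"
proof -
  have "distinct w \<longleftrightarrow> (\<forall>e. count (mset w) e \<le> 1)" for w :: gauss_word
    by (induction w) (auto simp: count_eq_zero_iff le_Suc_eq)
  then show ?thesis by (simp add: gauss_diagram_def paired_def)
qed

lemma paired_add_chord:
  "paired (add_mset (Over c s) (add_mset (Under c s) A)) \<longleftrightarrow>
     paired A \<and> c \<notin> chord ` set_mset A \<and> s \<in> {1, -1}"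
  (is "paired ?B \<longleftrightarrow> _")
proof
  assume B: "paired ?B"
  then have cnt: "count ?B e \<le> 1" for e by (simp add: paired_def)
  have "Over c s \<in># ?B" by simp
  with B obtain t where t: "t \<in> {1, -1}"
    "{x \<in> set_mset ?B. chord x = c} = {Over c t, Under c t}"
    unfolding paired_def by fastforce
  have "Over c s \<in> {x \<in> set_mset ?B. chord x = c}" by simp
  with t have ts: "t = s" by simp
  have nO: "Over c s \<notin># A" using cnt[of "Over c s"] by (auto simp flip: count_eq_zero_iff)
  have nU: "Under c s \<notin># A" using cnt[of "Under c s"] by (auto simp flip: count_eq_zero_iff)
  have c: "c \<notin> chord ` set_mset A"
  proof
    assume "c \<in> chord ` set_mset A"
    then obtain x where x: "x \<in># A" "chord x = c" by auto
    then have "x \<in> {x \<in> set_mset ?B. chord x = c}" by simp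
    then have "x \<in> {Over c s, Under c s}" unfolding t(2) ts .
    then show False using x nO nU by auto
  qed
  have "paired A"
    unfolding paired_def
  proof (intro conjI allI ballI)
    show "count A e \<le> 1" for e using cnt[of e] by (simp split: if_splits)
    fix e assume e: "e \<in># A"
    then obtain r where r: "r \<in> {1, -1}"
      "{x \<in> set_mset ?B. chord x = chord e} = {Over (chord e) r, Under (chord e) r}"
      using B unfolding paired_def by fastforce
    have "chord e \<noteq> c" using e c by auto
    then have "{x \<in> set_mset ?B. chord x = chord e} = {x \<in> set_mset A. chord x = chord e}" by auto
    with r show "\<exists>s\<in>{1, -1}. {x \<in> set_mset A. chord x = chord e} =
        {Over (chord e) s, Under (chord e) s}" by auto
  qed
  then show "paired A \<and> c \<notin> chord ` set_mset A \<and> s \<in> {1, -1}" using c t ts by auto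
next
  assume *: "paired A \<and> c \<notin> chord ` set_mset A \<and> s \<in> {1, -1}"
  show "paired ?B"
    unfolding paired_def
  proof (intro conjI allI ballI)
    show "count ?B e \<le> 1" for e
    proof (cases "chord e = c")
      case True
      then have "e \<notin># A" using * by auto
      then have "count A e = 0" by (simp add: count_eq_zero_iff)
      then show ?thesis by auto
    next
      case False
      then have "e \<noteq> Over c s" "e \<noteq> Under c s" by auto
      then show ?thesis using * by (simp add: paired_def)
    qed
    fix e assume e: "e \<in># ?B"
    show "\<exists>s\<in>{1, -1}. {x \<in> set_mset ?B. chord x = chord e} =
        {Over (chord e) s, Under (chord e) s}"
    proof (cases "chord e = c")
      case True
      have "x \<notin># A" if "chord x = c" for x using * that by blast
      then have "{x \<in> set_mset ?B. chord x = c} = {Over c s, Under c s}"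
        by auto
      then show ?thesis using * True by blast
    next
      case False
      then have "e \<in># A" using e by auto
      then obtain r where r: "r \<in> {1, -1}"
        "{x \<in> set_mset A. chord x = chord e} = {Over (chord e) r, Under (chord e) r}"
        using * unfolding paired_def by fastforce
      have "{x \<in> set_mset ?B. chord x = chord e} = {x \<in> set_mset A. chord x = chord e}"
        using False by auto
      with r show ?thesis by auto
    qed
  qed
qed

definition chord_ends :: "(nat \<times> int) list \<Rightarrow> nat endpoint multiset" where
  "chord_ends l = (\<Sum>(c, s)\<leftarrow>l. {#Over c s, Under c s#})"

lemma chord_ends_simps [simp]:
  "chord_ends [] = {#}"
  "chord_ends ((c, s) # l) = add_mset (Over c s) (add_mset (Under c s) (chord_ends l))"
  by (simp_all add: chord_ends_def)

lemma paired_empty [simp]: "paired {#}"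
  by (simp add: paired_def)

lemma chord_chord_ends: "chord ` set_mset (chord_ends l) = fst ` set l"
proof (induction l)
  case (Cons p l)
  then show ?case by (cases p) (simp add: insert_commute)
qed simp

text \<open>
  All validity side conditions below are discharged by this criterion: the endpoints in the arcs of
  a move are written as \<open>chord_ends\<close> of the chords present there.
\<close>

lemma paired_chord_ends:
  "paired (A + chord_ends l) \<longleftrightarrow> paired A \<and> distinct (map fst l) \<and>
     (\<forall>(c, s)\<in>set l. c \<notin> chord ` set_mset A \<and> s \<in> {1, -1})"
proof (induction l)
  case (Cons p l)
  obtain c s where p: "p = (c, s)" by fastforce
  have "A + chord_ends (p # l) = add_mset (Over c s) (add_mset (Under c s) (A + chord_ends l))"
    by (simp add: p)
  then show ?case
    unfolding p by (simp only: paired_add_chord Cons) (auto simp: image_Un chord_chord_ends p)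
qed simp

lemma pair_eq_chord_ends: "{#x, opp x#} = chord_ends [(chord x, chord_sign x)]"
  by (cases x) (simp_all add: add_mset_commute)

lemma paired_opp:
  assumes "paired A" "x \<in># A"
  shows "opp x \<in># A"
proof -
  obtain s where s: "{y \<in> set_mset A. chord y = chord x} = {Over (chord x) s, Under (chord x) s}"
    using assms unfolding paired_def by blast
  have "x \<in> {y \<in> set_mset A. chord y = chord x}" using assms by simp
  then have "x = Over (chord x) s \<or> x = Under (chord x) s" using s by simp
  then have "opp x \<in> {Over (chord x) s, Under (chord x) s}" by (metis insertI1 insertI2 opp.simps)
  then show ?thesis using s by blast
qed

lemma paired_same_chord:
  assumes "paired A" "x \<in># A" "y \<in># A" "chord y = chord x"
  shows "y = x \<or> y = opp x"
proof -
  obtain s where s: "{y \<in> set_mset A. chord y = chord x} = {Over (chord x) s, Under (chord x) s}"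
    using assms unfolding paired_def by blast
  have "x \<in> {y \<in> set_mset A. chord y = chord x}" "y \<in> {y \<in> set_mset A. chord y = chord x}"
    using assms by simp_all
  then show ?thesis unfolding s by (cases x; cases y) auto
qed


section \<open>Contexts\<close>

definition plug :: "gauss_word list \<Rightarrow> (nat + nat endpoint) list \<Rightarrow> gauss_word" where
  "plug ws v = concat (map (case_sum (\<lambda>k. ws ! k) (\<lambda>e. [e])) v)"

lemma plug_simps [simp]:
  "plug ws [] = []"
  "plug ws (Inl k # v) = ws ! k @ plug ws v"
  "plug ws (Inr e # v) = e # plug ws v"
  "plug ws (u @ v) = plug ws u @ plug ws v"
  "plug ws (map Inr w) = w"
  by (simp_all add: plug_def comp_def)

lemma fill_plug: "fill C ws = map (plug ws) C"
  by (simp add: fill_def plug_def)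

definition word_holes :: "(nat + 'e) list \<Rightarrow> nat list" where
  "word_holes v = map projl (filter isl v)"

lemma word_holes_simps [simp]:
  "word_holes [] = []"
  "word_holes (Inl k # v) = k # word_holes v"
  "word_holes (Inr e # v) = word_holes v"
  "word_holes (u @ v) = word_holes u @ word_holes v"
  "word_holes (map Inr w) = []"
  by (simp_all add: word_holes_def comp_def)

lemma holes_word_holes: "holes C = word_holes (concat C)"
  by (simp add: holes_def word_holes_def)

definition word_loose :: "(nat + 'e) list \<Rightarrow> 'e list" where
  "word_loose v = map projr (filter (\<lambda>x. \<not> isl x) v)"

lemma word_loose_simps [simp]:
  "word_loose [] = []"
  "word_loose (Inl k # v) = word_loose v"
  "word_loose (Inr e # v) = e # word_loose v"
  "word_loose (u @ v) = word_loose u @ word_loose v"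
  "word_loose (map Inr w) = w"
  by (simp_all add: word_loose_def comp_def)

lemma mset_word_holes_cong: "mset u = mset v \<Longrightarrow> mset (word_holes u) = mset (word_holes v)"
  by (simp add: word_holes_def)

lemma mset_word_loose_cong: "mset u = mset v \<Longrightarrow> mset (word_loose u) = mset (word_loose v)"
  by (simp add: word_loose_def)

text \<open>
  The endpoints outside the arcs.  They are the same before and after a move.
\<close>

definition loose :: "gauss_context \<Rightarrow> nat endpoint multiset" where
  "loose C = mset (word_loose (concat C))"

definition arcs :: "nat \<Rightarrow> gauss_context \<Rightarrow> bool" where
  "arcs m C \<longleftrightarrow> mset (holes C) = mset [0..<m]"

lemma arcs_iff: "arcs m C \<longleftrightarrow> distinct (holes C) \<and> set (holes C) = {..<m}"
proof
  assume "arcs m C"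
  then have *: "mset (holes C) = mset [0..<m]" unfolding arcs_def .
  have "set (holes C) = {..<m}"
    unfolding mset_eq_setD[OF *] by (simp add: atLeast0LessThan)
  then show "distinct (holes C) \<and> set (holes C) = {..<m}"
    unfolding mset_eq_imp_distinct_iff[OF *] by simp
next
  assume *: "distinct (holes C) \<and> set (holes C) = {..<m}"
  then have "set (holes C) = set [0..<m]" by (simp add: atLeast0LessThan)
  then show "arcs m C"
    unfolding arcs_def using * set_eq_iff_mset_eq_distinct distinct_upt by blast
qed

lemma mset_plug:
  "mset (plug ws v) = mset (word_loose v) + mset (concat (map ((!) ws) (word_holes v)))"
proof (induction v)
  case (Cons x v)
  then show ?case by (cases x) simp_all
qed simp

lemma concat_fill: "concat (fill C ws) = plug ws (concat C)"
  by (induction C) (simp_all add: fill_plug)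

lemma mset_concat_cong:
  assumes "mset ws = mset vs"
  shows "mset (concat ws) = mset (concat vs)"
proof -
  have "mset (concat us) = \<Sum>\<^sub># (image_mset mset (mset us))" for us :: "'a list list"
    by (induction us) simp_all
  then show ?thesis using assms by simp
qed

lemma mset_nth_holes:
  assumes "arcs (length ws) C"
  shows "mset (concat (map ((!) ws) (holes C))) = mset (concat ws)"
proof (rule mset_concat_cong)
  have "mset (map ((!) ws) (holes C)) = image_mset ((!) ws) (mset [0..<length ws])"
    using assms unfolding arcs_def by (simp only: mset_map)
  also have "\<dots> = mset (map ((!) ws) [0..<length ws])" by (simp only: mset_map)
  also have "\<dots> = mset ws" by (simp only: map_nth)
  finally show "mset (map ((!) ws) (holes C)) = mset ws" .
qed

text \<open>
  Every hole occurs once, so filling adds up the endpoints outside and inside the arcs.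
\<close>

lemma mset_fill:
  assumes "arcs (length ws) C"
  shows "mset (concat (fill C ws)) = loose C + mset (concat ws)"
  using mset_nth_holes[OF assms] by (simp add: concat_fill mset_plug loose_def holes_word_holes)

lemma gauss_diagram_fill:
  assumes "arcs (length ws) C"
  shows "gauss_diagram n (fill C ws) \<longleftrightarrow> length C = n \<and> paired (loose C + mset (concat ws))"
  using mset_fill[OF assms] by (simp add: gauss_diagram_iff fill_plug)

text \<open>
  Refining a context: hole \<open>k\<close> is replaced by the word \<open>vs ! k\<close>, which may contain endpoints and new
  holes.  In this way a move is performed inside arcs that already carry other endpoints.
\<close>

definition graft :: "gauss_context \<Rightarrow> gauss_context \<Rightarrow> gauss_context" where
  "graft C vs = map (\<lambda>w. concat (map (case_sum (\<lambda>k. vs ! k) (\<lambda>e. [Inr e])) w)) C"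

lemma fill_graft:
  assumes "arcs (length vs) C"
  shows "fill (graft C vs) ws = fill C (map (plug ws) vs)"
proof -
  have "plug ws (concat (map (case_sum (\<lambda>k. vs ! k) (\<lambda>e. [Inr e])) w)) = plug (map (plug ws) vs) w"
    if "set (word_holes w) \<subseteq> {..<length vs}" for w
    using that
  proof (induction w)
    case (Cons x w)
    then show ?case by (cases x) simp_all
  qed simp
  moreover have "set (word_holes w) \<subseteq> {..<length vs}" if "w \<in> set C" for w
  proof -
    have "set (word_holes w) \<subseteq> set (holes C)"
      using that by (auto simp: holes_def word_holes_def)
    then show ?thesis using assms by (simp add: arcs_iff)
  qed
  ultimately show ?thesis unfolding graft_def fill_plug map_map comp_def by (intro map_cong refl) blast
qed

lemma graft_holes_loose:
  assumes "arcs (length vs) C"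
  shows "mset (holes (graft C vs)) = mset (word_holes (concat vs))"
    and "loose (graft C vs) = loose C + mset (word_loose (concat vs))"
proof -
  have perm: "mset (concat (map ((!) vs) (holes C))) = mset (concat vs)"
    by (rule mset_nth_holes[OF assms])
  have flat: "concat (graft C vs) = concat (map (case_sum (\<lambda>k. vs ! k) (\<lambda>e. [Inr e])) (concat C))"
    by (induction C) (simp_all add: graft_def)
  have h: "word_holes (concat (map (case_sum (\<lambda>k. vs ! k) (\<lambda>e. [Inr e])) v)) =
      word_holes (concat (map ((!) vs) (word_holes v)))" for v :: "(nat + nat endpoint) list"
  proof (induction v)
    case (Cons x v)
    then show ?case by (cases x) simp_all
  qed simp
  have l: "mset (word_loose (concat (map (case_sum (\<lambda>k. vs ! k) (\<lambda>e. [Inr e])) v))) =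
      mset (word_loose v) + mset (word_loose (concat (map ((!) vs) (word_holes v))))"
    for v :: "(nat + nat endpoint) list"
  proof (induction v)
    case (Cons x v)
    then show ?case by (cases x) simp_all
  qed simp
  show "mset (holes (graft C vs)) = mset (word_holes (concat vs))"
    unfolding holes_word_holes[of "graft C vs"] flat h
    using mset_word_holes_cong[OF perm] by (simp only: holes_word_holes)
  show "loose (graft C vs) = loose C + mset (word_loose (concat vs))"
    unfolding loose_def flat l
    using mset_word_loose_cong[OF perm] by (simp only: holes_word_holes)
qed

lemma arcs_graft:
  assumes "arcs (length vs) C" "mset (word_holes (concat vs)) = mset [0..<m]"
  shows "arcs m (graft C vs)"
  using graft_holes_loose(1)[OF assms(1)] assms(2) by (simp add: arcs_def)


section \<open>Moves in a context\<close>

abbreviation vequiv :: "gauss_code \<Rightarrow> gauss_code \<Rightarrow> bool" (infix "\<approx>" 50) where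
  "G \<approx> G' \<equiv> equivclp vDelta_step G G'"

lemma vequiv_sym: "G \<approx> G' \<Longrightarrow> G' \<approx> G"
  by (rule equivclp_sym)

lemma vequiv_trans [trans]: "G \<approx> H \<Longrightarrow> H \<approx> K \<Longrightarrow> G \<approx> K"
  by (rule equivclp_trans)

lemma pattern_length:
  "reidemeister_pattern as bs \<or> vDelta_pattern as bs \<Longrightarrow> length as = length bs"
  by (auto elim!: reidemeister_pattern.cases vDelta_pattern.cases)

text \<open>
  All applications of moves have this form.  The \<open>k\<close>th arc of the surrounding context is described by
  \<open>vs ! k\<close>: its endpoints are untouched, its holes are the arcs of the pattern.
\<close>

lemma vequiv_pattern:
  assumes P: "reidemeister_pattern as bs \<or> vDelta_pattern as bs"
    and C: "arcs (length vs) C"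
    and vs: "mset (word_holes (concat vs)) = mset [0..<length as]"
    and U: "U = map (plug as) vs" "paired (loose C + mset (concat U))"
    and V: "V = map (plug bs) vs" "paired (loose C + mset (concat V))"
  shows "fill C U \<approx> fill C V"
proof -
  have "arcs (length as) (graft C vs)"
    using C vs by (rule arcs_graft)
  moreover have "length as = length bs" using P by (rule pattern_length)
  moreover have "fill C U = fill (graft C vs) as" "fill C V = fill (graft C vs) bs"
    using C by (simp_all add: U V fill_graft)
  moreover have "gauss_diagram (length (fill C U)) (fill C U)"
    "gauss_diagram (length (fill C V)) (fill C V)"
    using C U V by (simp_all add: gauss_diagram_fill) (simp_all add: fill_plug)
  ultimately have "local_move reidemeister_pattern (fill C U) (fill C V) \<or>
      local_move vDelta_pattern (fill C U) (fill C V)"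
    using P unfolding local_move_def arcs_iff by blast
  then have "vDelta_step (fill C U) (fill C V)"
    unfolding vDelta_step_def reidemeister_step_def by blast
  then show ?thesis by (rule r_into_equivclp)
qed

text \<open>
  The second move is symmetric in its two chords, so on either arc the endpoints may come in any
  order.
\<close>

lemma R2_pattern:
  assumes "s \<in> {1, -1}"
    and "u \<in> {[Over a s, Over b (- s)], [Over b (- s), Over a s]}"
    and "v \<in> {[Under a s, Under b (- s)], [Under b (- s), Under a s]}"
  shows "reidemeister_pattern [[], []] [u, v]"
proof -
  have "reidemeister_pattern [[], []] [[Over a r, Over b (- r)], [Under a r, Under b (- r)]]"
    "reidemeister_pattern [[], []] [[Over a r, Over b (- r)], [Under b (- r), Under a r]]"
    if "r \<in> {1, -1}" for r a b
    using R2[OF that, of 1 a b] R2[OF that, of "-1" a b] by (simp_all add: along_def)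
  from this[of s a b] this[of "- s" b a] show ?thesis
    using assms by auto
qed

lemma R1_pattern:
  assumes "chord_sign x \<in> {1, -1}"
  shows "reidemeister_pattern [[]] [[x, opp x]]"
proof (cases x)
  case (Over c s)
  then show ?thesis using R1[of s 1 c] assms by (auto simp: along_def)
next
  case (Under c s)
  then show ?thesis using R1[of s "-1" c] assms by (auto simp: along_def)
qed

lemma vequiv_isolated_chord:
  assumes "arcs 1 C" "paired (loose C + {#x, opp x#})"
  shows "fill C [[]] \<approx> fill C [[x, opp x]]"
proof -
  have *: "paired (loose C)" "chord_sign x \<in> {1, -1}"
    using assms(2) unfolding pair_eq_chord_ends paired_chord_ends by auto
  show ?thesis
  proof (rule vequiv_pattern[where vs = "[[Inl 0]]"])
    show "reidemeister_pattern [[]] [[x, opp x]] \<or> vDelta_pattern [[]] [[x, opp x]]"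
      using R1_pattern * by blast
  qed (use assms * in simp_all)
qed

lemma fresh_label:
  fixes F :: "nat set"
  assumes "finite F"
  obtains a where "a \<notin> F"
  using ex_new_if_finite[OF infinite_UNIV_nat assms] by blast

text \<open>
  The central trick.  Relative to the chord \<open>a\<close> from arc 0 to arc 1, a Delta-move inserts an
  auxiliary chord \<open>d\<close> of opposite sign, parallel to \<open>a\<close>, together with a chord \<open>b\<close> from arc 1 to arc 2
  and a chord \<open>c\<close> from arc 2 to arc 0.  The new endpoints are put on the side of \<open>a\<close> on which \<open>d\<close>
  becomes adjacent to \<open>a\<close>; then \<open>a\<close> and \<open>d\<close> cancel.  The sign condition of the Delta-move is no
  restriction: for any three signs there are exactly two choices of the \<open>\<eta>\<close>s, which differ by a
  global sign, and this freedom is used to prescribe \<open>\<eta>\<close> on arc 2.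
\<close>

lemma vequiv_detour:
  assumes C: "arcs 3 C" and loose: "paired (loose C)"
    and fresh: "{a, b, c} \<inter> chord ` set_mset (loose C) = {}" "distinct [a, b, c]"
    and signs: "s \<in> {1, -1}" "t \<in> {1, -1}" "u \<in> {1, -1}" "\<eta> \<in> {1, -1}"
  shows "fill C [[Over a s], [Under a s], []] \<approx>
    fill C [[Under c t], [Over b u], along \<eta> (Under b u) (Over c t)]"
proof -
  obtain d where d: "d \<notin> {a, b, c} \<union> chord ` set_mset (loose C)"
    using fresh_label[of "{a, b, c} \<union> chord ` set_mset (loose C)"] by auto
  \<comment> \<open>The solution of \<open>\<delta> * \<eta>1 * \<eta>2 = - s\<close>, \<open>\<delta> * \<eta>2 * \<eta> = u\<close> and \<open>\<delta> * \<eta> * \<eta>1 = t\<close>;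
    the product of the three equations gives \<open>\<delta> = - s * t * u\<close>.\<close>
  define \<eta>1 where "\<eta>1 = - s * u * \<eta>"
  define \<eta>2 where "\<eta>2 = - s * t * \<eta>"
  have \<eta>: "\<eta>1 \<in> {1, -1}" "\<eta>2 \<in> {1, -1}"
    using signs unfolding \<eta>1_def \<eta>2_def by auto
  have pat: "vDelta_pattern [[], [], []] [along \<eta>1 (Under c t) (Over d (- s)),
      along \<eta>2 (Under d (- s)) (Over b u), along \<eta> (Under b u) (Over c t)]"
    by (rule vDelta_pattern.intros[where \<delta> = "- s * t * u"])
      (use signs in \<open>auto simp: \<eta>1_def \<eta>2_def\<close>)
  \<comment> \<open>The diagram after the Delta-move, with \<open>d\<close> next to \<open>a\<close> on both arcs.\<close>
  define W where "W = [if \<eta>1 = 1 then [Under c t, Over d (- s), Over a s]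
      else [Over a s, Over d (- s), Under c t],
    if \<eta>2 = 1 then [Under a s, Under d (- s), Over b u] else [Over b u, Under d (- s), Under a s],
    along \<eta> (Under b u) (Over c t)]"
  have "mset (concat W) = chord_ends [(a, s), (b, u), (c, t), (d, - s)]"
    by (simp add: W_def along_def add_mset_commute)
  then have W: "paired (loose C + mset (concat W))"
    using loose fresh signs d by (auto simp: paired_chord_ends simp del: chord_ends_simps)
  have "mset (concat [[Over a s], [Under a s], []]) = chord_ends [(a, s)]" by simp
  then have A: "paired (loose C + mset (concat [[Over a s], [Under a s], []]))"
    using loose fresh signs d by (auto simp: paired_chord_ends simp del: chord_ends_simps)
  have "mset (concat [[Under c t], [Over b u], along \<eta> (Under b u) (Over c t)]) =
      chord_ends [(b, u), (c, t)]"
    by (simp add: along_def add_mset_commute)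
  then have B: "paired (loose C + mset (concat [[Under c t], [Over b u], along \<eta> (Under b u) (Over c t)]))"
    using loose fresh signs d by (auto simp: paired_chord_ends simp del: chord_ends_simps)
  have "fill C [[Over a s], [Under a s], []] \<approx> fill C W"
  proof (rule vequiv_pattern[OF disjI2[OF pat], where vs =
        "[if \<eta>1 = 1 then [Inl 0, Inr (Over a s)] else [Inr (Over a s), Inl 0],
          if \<eta>2 = 1 then [Inr (Under a s), Inl 1] else [Inl 1, Inr (Under a s)],
          [Inl 2]]"])
  qed (use C W A \<eta> in \<open>auto simp: W_def along_def add_mset_commute numeral_3_eq_3\<close>)
  also have "fill C W \<approx> fill C [[Under c t], [Over b u], along \<eta> (Under b u) (Over c t)]"
  proof (rule vequiv_sym, rule vequiv_pattern[where as = "[[], []]" and bs =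
        "[if \<eta>1 = 1 then [Over d (- s), Over a s] else [Over a s, Over d (- s)],
          if \<eta>2 = 1 then [Under a s, Under d (- s)] else [Under d (- s), Under a s]]" and vs =
        "[if \<eta>1 = 1 then [Inr (Under c t), Inl 0] else [Inl 0, Inr (Under c t)],
          if \<eta>2 = 1 then [Inl 1, Inr (Over b u)] else [Inr (Over b u), Inl 1],
          map Inr (along \<eta> (Under b u) (Over c t))]"])
    show "reidemeister_pattern [[], []]
        [if \<eta>1 = 1 then [Over d (- s), Over a s] else [Over a s, Over d (- s)],
          if \<eta>2 = 1 then [Under a s, Under d (- s)] else [Under d (- s), Under a s]] \<or>
      vDelta_pattern [[], []]
        [if \<eta>1 = 1 then [Over d (- s), Over a s] else [Over a s, Over d (- s)],
          if \<eta>2 = 1 then [Under a s, Under d (- s)] else [Under d (- s), Under a s]]"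
      by (rule disjI1, rule R2_pattern[of s _ a d]) (use signs in auto)
  qed (use C W B \<eta> in \<open>auto simp: W_def add_mset_commute numeral_3_eq_3\<close>)
  finally show ?thesis .
qed

text \<open>
  The detour is taken through a point right behind the initial endpoint of \<open>a\<close>, where its second
  chord \<open>c\<close> becomes isolated.
\<close>

lemma vequiv_reverse:
  assumes C: "arcs 2 C" and loose: "paired (loose C)"
    and fresh: "{a, b} \<inter> chord ` set_mset (loose C) = {}" "a \<noteq> b"
    and signs: "s \<in> {1, -1}" "t \<in> {1, -1}"
  shows "fill C [[Over a s], [Under a s]] \<approx> fill C [[Under b t], [Over b t]]"
proof -
  obtain c where c: "c \<notin> {a, b} \<union> chord ` set_mset (loose C)"
    using fresh_label[of "{a, b} \<union> chord ` set_mset (loose C)"] by auto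
  \<comment> \<open>Arc 2 of the detour immediately follows arc 0.\<close>
  let ?v = "[[Inl 0, Inl 2], [Inl 1]] :: gauss_context"
  let ?D = "graft C ?v"
  have C': "arcs (length ?v) C" using C by (simp add: numeral_2_eq_2)
  have D: "arcs 3 ?D" "loose ?D = loose C"
    using arcs_graft[OF C', of 3] graft_holes_loose(2)[OF C']
    by (auto simp: numeral_3_eq_3 numeral_2_eq_2)
  have "fill C [[Over a s], [Under a s]] = fill ?D [[Over a s], [Under a s], []]"
    using C' by (simp add: fill_graft)
  also have "\<dots> \<approx> fill ?D [[Under c 1], [Over b t], along (-1) (Under b t) (Over c 1)]"
    by (rule vequiv_detour) (use D loose fresh signs c in auto)
  also have "\<dots> = fill C [[Under c 1, Over c 1, Under b t], [Over b t]]"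
    using C' by (simp add: fill_graft along_def)
  also have "\<dots> \<approx> fill C [[Under b t], [Over b t]]"
  proof (rule vequiv_sym, rule vequiv_pattern[where vs = "[[Inl 0, Inr (Under b t)], [Inr (Over b t)]]"])
    show "reidemeister_pattern [[]] [[Under c 1, Over c 1]] \<or> vDelta_pattern [[]] [[Under c 1, Over c 1]]"
      using R1_pattern[of "Under c 1"] by simp
    have "mset (concat [[Under b t], [Over b t]]) = chord_ends [(b, t)]"
      "mset (concat [[Under c 1, Over c 1, Under b t], [Over b t]]) = chord_ends [(b, t), (c, 1)]"
      by (simp_all add: add_mset_commute)
    then show "paired (loose C + mset (concat [[Under b t], [Over b t]]))"
      "paired (loose C + mset (concat [[Under c 1, Over c 1, Under b t], [Over b t]]))"
      using loose fresh signs c by (auto simp: paired_chord_ends simp del: chord_ends_simps)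
  qed (use C' in simp_all)
  finally show ?thesis .
qed

text \<open>
  A chord can be changed to any other chord with the same two end positions, in particular to one
  with another sign, orientation or label: each of them is related by one or two reversals to the
  same auxiliary chord.
\<close>

lemma vequiv_replace_chord:
  assumes C: "arcs 2 C" and loose: "paired (loose C)"
    and x: "chord x \<notin> chord ` set_mset (loose C)" "chord_sign x \<in> {1, -1}"
    and y: "chord y \<notin> chord ` set_mset (loose C)" "chord_sign y \<in> {1, -1}"
  shows "fill C [[x], [opp x]] \<approx> fill C [[y], [opp y]]"
proof -
  obtain c where c: "c \<notin> {chord x, chord y} \<union> chord ` set_mset (loose C)"
    using fresh_label[of "{chord x, chord y} \<union> chord ` set_mset (loose C)"] by auto
  obtain d where d: "d \<notin> {chord x, chord y, c} \<union> chord ` set_mset (loose C)"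
    using fresh_label[of "{chord x, chord y, c} \<union> chord ` set_mset (loose C)"] by auto
  have rev: "fill C [[Over a s], [Under a s]] \<approx> fill C [[Under b t], [Over b t]]"
    if "a \<noteq> b" "{a, b} \<inter> chord ` set_mset (loose C) = {}" "s \<in> {1, -1}" "t \<in> {1, -1}" for a b s t
    using vequiv_reverse[OF C loose] that by blast
  have to_d: "fill C [[z], [opp z]] \<approx> fill C [[Over d 1], [Under d 1]]"
    if z: "z \<in> {x, y}" for z
  proof (cases z)
    case (Over a s)
    have "fill C [[Over a s], [Under a s]] \<approx> fill C [[Under c 1], [Over c 1]]"
      by (rule rev) (use z x y c Over in auto)
    also have "\<dots> \<approx> fill C [[Over d 1], [Under d 1]]"
      by (rule vequiv_sym, rule rev) (use c d in auto)
    finally show ?thesis using Over by simp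
  next
    case (Under a s)
    have "fill C [[Under a s], [Over a s]] \<approx> fill C [[Over d 1], [Under d 1]]"
      by (rule vequiv_sym, rule rev) (use z x y d Under in auto)
    then show ?thesis using Under by simp
  qed
  show ?thesis
    using to_d[of x] to_d[of y] vequiv_sym vequiv_trans by blast
qed

text \<open>
  After a change of orientations, the two adjacent endpoints are the terminal endpoint of one chord
  and the initial endpoint of the other.  Such a pair of chords is a detour of a third chord, and a
  detour exists with either order at the middle point.
\<close>

lemma vequiv_swap_arc:
  assumes C: "arcs 3 C" and loose: "paired (loose C)"
    and ne: "chord x \<noteq> chord y"
    and x: "chord x \<notin> chord ` set_mset (loose C)" "chord_sign x \<in> {1, -1}"
    and y: "chord y \<notin> chord ` set_mset (loose C)" "chord_sign y \<in> {1, -1}"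
  shows "fill C [[x, y], [opp x], [opp y]] \<approx> fill C [[y, x], [opp x], [opp y]]"
proof -
  let ?X = "Under (chord x) 1" and ?Y = "Over (chord y) 1"
  have C': "arcs (length [p, q, r]) C" for p q r :: "(nat + nat endpoint) list"
    using C by (simp add: numeral_3_eq_3)
  have graft2: "fill C (map (plug [[z], [opp z]]) vs) \<approx> fill C (map (plug [[z'], [opp z']]) vs)"
    if vs: "length vs = 3" "mset (word_holes (concat vs)) = mset [0..<2]"
      "mset (word_loose (concat vs)) = {#w, opp w#}"
    and z: "chord z \<notin> insert (chord w) (chord ` set_mset (loose C))" "chord_sign z \<in> {1, -1}"
    and z': "chord z' \<notin> insert (chord w) (chord ` set_mset (loose C))" "chord_sign z' \<in> {1, -1}"
    and w: "chord w \<notin> chord ` set_mset (loose C)" "chord_sign w \<in> {1, -1}"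
    for vs z z' w
  proof -
    have arcs: "arcs (length vs) C" using C vs by simp
    have "loose (graft C vs) = loose C + chord_ends [(chord w, chord_sign w)]"
      using graft_holes_loose(2)[OF arcs] vs(3) by (simp only: pair_eq_chord_ends)
    moreover have "paired (loose C + chord_ends [(chord w, chord_sign w)])"
      using loose w unfolding paired_chord_ends by auto
    moreover have "chord ` set_mset (loose C + chord_ends [(chord w, chord_sign w)]) =
        insert (chord w) (chord ` set_mset (loose C))"
      unfolding set_mset_union image_Un chord_chord_ends by simp
    ultimately have "fill (graft C vs) [[z], [opp z]] \<approx> fill (graft C vs) [[z'], [opp z']]"
      using z z' by (intro vequiv_replace_chord arcs_graft[OF arcs vs(2)]) auto
    then show ?thesis by (simp add: fill_graft[OF arcs])
  qed
  have standard: "fill C [[x, y], [opp x], [opp y]] \<approx> fill C [[?X, ?Y], [opp ?X], [opp ?Y]]"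
  proof -
    have "fill C [[x, y], [opp x], [opp y]] \<approx> fill C [[?X, y], [opp ?X], [opp y]]"
      using graft2[of "[[Inl 0, Inr y], [Inl 1], [Inr (opp y)]]" y x ?X] x y ne
      by (simp add: numeral_2_eq_2)
    also have "\<dots> \<approx> fill C [[?X, ?Y], [opp ?X], [opp ?Y]]"
      using graft2[of "[[Inr ?X, Inl 0], [Inr (opp ?X)], [Inl 1]]" ?X y ?Y] x y ne
      by (simp add: numeral_2_eq_2)
    finally show ?thesis .
  qed
  have standard': "fill C [[y, x], [opp x], [opp y]] \<approx> fill C [[?Y, ?X], [opp ?X], [opp ?Y]]"
  proof -
    have "fill C [[y, x], [opp x], [opp y]] \<approx> fill C [[y, ?X], [opp ?X], [opp y]]"
      using graft2[of "[[Inr y, Inl 0], [Inl 1], [Inr (opp y)]]" y x ?X] x y ne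
      by (simp add: numeral_2_eq_2)
    also have "\<dots> \<approx> fill C [[?Y, ?X], [opp ?X], [opp ?Y]]"
      using graft2[of "[[Inl 0, Inr ?X], [Inr (opp ?X)], [Inl 1]]" ?X y ?Y] x y ne
      by (simp add: numeral_2_eq_2)
    finally show ?thesis .
  qed
  \<comment> \<open>In \<open>vequiv_detour\<close> the middle point is the last arc, here it is the first.\<close>
  let ?v = "[[Inl 2], [Inl 1], [Inl 0]] :: gauss_context"
  let ?D = "graft C ?v"
  have D: "arcs 3 ?D" "loose ?D = loose C"
    using arcs_graft[OF C', of _ _ _ 3] graft_holes_loose(2)[OF C']
    by (auto simp: numeral_3_eq_3 numeral_2_eq_2 add_mset_commute)
  obtain a where a: "a \<notin> {chord x, chord y} \<union> chord ` set_mset (loose C)"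
    using fresh_label[of "{chord x, chord y} \<union> chord ` set_mset (loose C)"] by auto
  have detour: "fill ?D [[Over a 1], [Under a 1], []] \<approx>
      fill ?D [[opp ?Y], [opp ?X], along \<eta> ?X ?Y]" if "\<eta> \<in> {1, -1}" for \<eta>
    unfolding opp.simps by (rule vequiv_detour) (use D loose ne x y a that in auto)
  have "fill C [[?X, ?Y], [opp ?X], [opp ?Y]] \<approx> fill ?D [[Over a 1], [Under a 1], []]"
    using vequiv_sym[OF detour[of 1]] by (simp add: fill_graft[OF C'] along_def)
  also have "\<dots> \<approx> fill C [[?Y, ?X], [opp ?X], [opp ?Y]]"
    using detour[of "-1"] by (simp add: fill_graft[OF C'] along_def)
  finally show ?thesis
    using standard standard' vequiv_sym vequiv_trans by blast
qed


section \<open>The order of the endpoints on a circle\<close>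

lemma plug_append:
  assumes "set (word_holes v) \<subseteq> {..<length ws}"
  shows "plug (ws @ ws') v = plug ws v"
  using assms
proof (induction v)
  case (Cons x v)
  then show ?case by (cases x) (simp_all add: nth_append)
qed simp

text \<open>
  Any endpoint outside the arcs can be made an arc of its own.  This provides the contexts in which
  \<open>vequiv_swap_arc\<close> is applied, wherever the other endpoints of the two chords lie.
\<close>

lemma mark_endpoint:
  assumes C: "arcs m C" and e: "e \<in># loose C"
  obtains C' where "arcs (Suc m) C'" "loose C = add_mset e (loose C')"
    "\<And>ws. length ws = m \<Longrightarrow> fill C' (ws @ [[e]]) = fill C ws"
proof -
  have "Inr e \<in> set (concat C)"
    using e by (auto simp: loose_def word_loose_def)
  then obtain w where "w \<in> set C" "Inr e \<in> set w" by auto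
  then obtain p q u v where C_eq: "C = p @ (u @ Inr e # v) # q"
    by (metis split_list)
  define C' where "C' = p @ (u @ Inl m # v) # q"
  have "arcs (Suc m) C'"
    using C by (simp add: arcs_def holes_word_holes C_eq C'_def)
  moreover have "loose C = add_mset e (loose C')"
    by (simp add: loose_def C_eq C'_def)
  moreover have "fill C' (ws @ [[e]]) = fill C ws" if ws: "length ws = m" for ws
  proof -
    have "set (word_holes w) \<subseteq> {..<length ws}" if "w \<in> set p \<union> {u, v} \<union> set q" for w
    proof -
      have "set (word_holes w) \<subseteq> set (holes C)"
        using that unfolding holes_def word_holes_def C_eq by auto
      then show ?thesis using C ws by (simp add: arcs_iff)
    qed
    then show ?thesis using ws by (simp add: fill_plug C_eq C'_def plug_append nth_append)
  qed
  ultimately show thesis using that by blast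
qed

lemma vequiv_swap_adjacent:
  assumes "gauss_diagram n (p @ (u @ x # y # v) # q)"
  shows "p @ (u @ x # y # v) # q \<approx> p @ (u @ y # x # v) # q"
proof -
  define C :: gauss_context where "C = map (map Inr) p @ (map Inr u @ Inl 0 # map Inr v) # map (map Inr) q"
  have concat_Inr: "concat (map (map Inr) r) = map Inr (concat r)" for r :: gauss_code
    by (simp add: map_concat)
  have map_Inr: "map (plug ws \<circ> map Inr) r = r" for ws r
    by (simp add: comp_def)
  have C: "arcs 1 C"
    by (simp add: arcs_def holes_word_holes C_def concat_Inr)
  have fill_C: "fill C [w] = p @ (u @ w @ v) # q" for w
    by (simp add: fill_plug C_def map_Inr)
  have pair: "paired (loose C + {#x, y#})"
    using assms gauss_diagram_fill[of "[[x, y]]" C n] C by (simp add: fill_C)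
  show ?thesis
  proof (cases "y = opp x")
    case True
    \<comment> \<open>The two endpoints of one isolated chord: delete it and insert it the other way round.\<close>
    then have "paired (loose C + {#y, opp y#})" using pair by (simp add: add_mset_commute)
    then have "fill C [[]] \<approx> fill C [[y, opp y]]" using C by (intro vequiv_isolated_chord)
    moreover have "fill C [[]] \<approx> fill C [[x, opp x]]"
      using C pair True by (intro vequiv_isolated_chord) auto
    ultimately have "fill C [[x, opp x]] \<approx> fill C [[y, opp y]]"
      using vequiv_sym vequiv_trans by blast
    then show ?thesis using True by (simp add: fill_C)
  next
    case False
    have "count (loose C + {#x, y#}) x \<le> 1" using pair unfolding paired_def by blast
    then have "x \<noteq> y" by auto
    have ox: "opp x \<in># loose C"
      using paired_opp[OF pair, of x] False by auto
    have "y = opp x" if "opp y = x" using that by auto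
    then have oy: "opp y \<in># loose C"
      using paired_opp[OF pair, of y] False by auto
    have ne: "chord x \<noteq> chord y"
      using paired_same_chord[OF pair, of x y] False \<open>x \<noteq> y\<close> by auto
    obtain C1 where C1: "arcs 2 C1" "loose C = add_mset (opp x) (loose C1)"
      "\<And>ws. length ws = 1 \<Longrightarrow> fill C1 (ws @ [[opp x]]) = fill C ws"
      using mark_endpoint[OF C ox] by (metis Suc_1)
    have "opp y \<noteq> opp x" using ne opp_simps(2) by metis
    then have "opp y \<in># loose C1" using oy unfolding C1(2) by simp
    then obtain C2 where C2: "arcs (Suc 2) C2" "loose C1 = add_mset (opp y) (loose C2)"
      "\<And>ws. length ws = 2 \<Longrightarrow> fill C2 (ws @ [[opp y]]) = fill C1 ws"
      using mark_endpoint[OF C1(1)] by blast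
    have arcs3: "arcs 3 C2" using C2(1) by (simp add: eval_nat_numeral)
    have fill_C2: "fill C2 [w, [opp x], [opp y]] = p @ (u @ w @ v) # q" for w
      using C2(3)[of "[w, [opp x]]"] C1(3)[of "[w]"] by (simp add: fill_C)
    have "loose C + {#x, y#} = loose C2 + ({#x, opp x#} + {#y, opp y#})"
      using C1(2) C2(2) by (simp add: add_mset_commute)
    also have "\<dots> = loose C2 + chord_ends [(chord x, chord_sign x), (chord y, chord_sign y)]"
      unfolding pair_eq_chord_ends by simp
    finally have "paired (loose C2 + chord_ends [(chord x, chord_sign x), (chord y, chord_sign y)])"
      using pair by simp
    then have "fill C2 [[x, y], [opp x], [opp y]] \<approx> fill C2 [[y, x], [opp x], [opp y]]"
      using arcs3 ne unfolding paired_chord_ends by (intro vequiv_swap_arc) auto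
    then show ?thesis by (simp add: fill_C2)
  qed
qed

text \<open>
  Adjacent transpositions generate all permutations.  The hypothesis on multisets in the step lets
  the induction keep track of validity.
\<close>

lemma mset_eq_induct_swap [consumes 1, case_names refl swap]:
  fixes u v :: "'a list"
  assumes "mset u = mset v"
    and refl: "Q u"
    and swap: "\<And>p x y q. mset (p @ x # y # q) = mset u \<Longrightarrow> Q (p @ x # y # q) \<Longrightarrow> Q (p @ y # x # q)"
  shows "Q v"
proof -
  define S where "S = (\<lambda>v w :: 'a list. \<exists>p x y q. v = p @ x # y # q \<and> w = p @ y # x # q)"
  have S_swap: "S (p @ x # y # q) (p @ y # x # q)" for p x y q
    unfolding S_def by blast
  have S_Cons: "S\<^sup>*\<^sup>* (a # v) (a # w)" if "S\<^sup>*\<^sup>* v w" for a and v w :: "'a list"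
    using that
  proof induction
    case (step w z)
    from step.hyps(2) obtain p x y q where "w = p @ x # y # q" "z = p @ y # x # q"
      unfolding S_def by blast
    then have "S (a # w) (a # z)" using S_swap[of "a # p" x y q] by simp
    with step.IH show ?case by (rule rtranclp.rtrancl_into_rtrancl)
  qed simp
  have bubble: "S\<^sup>*\<^sup>* (a # p @ q) (p @ a # q)" for a and p q :: "'a list"
  proof (induction p)
    case (Cons b p)
    have "S (a # b # p @ q) (b # a # p @ q)" using S_swap[of "[]"] by simp
    moreover have "S\<^sup>*\<^sup>* (b # a # p @ q) (b # p @ a # q)" using Cons by (rule S_Cons)
    ultimately show ?case by (simp add: converse_rtranclp_into_rtranclp)
  qed simp
  have "S\<^sup>*\<^sup>* u v" using \<open>mset u = mset v\<close>
  proof (induction u arbitrary: v)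
    case (Cons a u)
    then have "a \<in> set v" by (metis list.set_intros(1) mset_eq_setD)
    then obtain p q where v: "v = p @ a # q" by (metis split_list)
    then have "S\<^sup>*\<^sup>* u (p @ q)" using Cons by simp
    then have "S\<^sup>*\<^sup>* (a # u) (a # p @ q)" by (rule S_Cons)
    then show ?case using bubble[of a p q] v by simp
  qed simp
  then have "mset v = mset u \<and> Q v"
  proof induction
    case (step w z)
    then obtain p x y q where "w = p @ x # y # q" "z = p @ y # x # q" unfolding S_def by blast
    then show ?case using step swap[of p x y q] by (auto simp: add_mset_commute)
  qed (simp add: refl)
  then show ?thesis ..
qed

lemma vequiv_permute_words:
  assumes G: "gauss_diagram n G" and GG': "list_all2 (\<lambda>u v. mset u = mset v) G G'"
  shows "G \<approx> G'"
proof -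
  have word: "p @ u # q \<approx> p @ v # q"
    if "mset u = mset v" "gauss_diagram n (p @ u # q)" for p q u v
    using that(1)
  proof (induction rule: mset_eq_induct_swap)
    case (swap u' x y v')
    have "mset (concat (p @ (u' @ x # y # v') # q)) =
        mset (concat p) + mset (u' @ x # y # v') + mset (concat q)"
      by simp
    also have "\<dots> = mset (concat (p @ u # q))" unfolding swap(1) by simp
    finally have "gauss_diagram n (p @ (u' @ x # y # v') # q)"
      using that(2) by (simp only: gauss_diagram_iff length_append list.size)
    from vequiv_swap_adjacent[OF this] swap(2) show ?case using vequiv_trans by blast
  qed simp
  have "p @ G \<approx> p @ G'" if "gauss_diagram n (p @ G)" for p
    using GG' that
  proof (induction arbitrary: p rule: list_all2_induct)
    case (Cons u G v G')
    have "p @ u # G \<approx> p @ v # G" using Cons by (intro word) simp_all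
    moreover have "gauss_diagram n ((p @ [v]) @ G)" using Cons by (simp add: gauss_diagram_iff)
    then have "(p @ [v]) @ G \<approx> (p @ [v]) @ G'" by (rule Cons.IH)
    ultimately show ?case using vequiv_trans by simp
  qed simp
  from this[of "[]"] show ?thesis using G by simp
qed

lemma vequiv_same_endpoints:
  assumes "gauss_diagram n G" "length G' = n" "\<And>k. k < n \<Longrightarrow> mset (G ! k) = mset (G' ! k)"
  shows "G \<approx> G'"
  using assms by (intro vequiv_permute_words) (auto simp: list_all2_conv_all_nth gauss_diagram_iff)


section \<open>Diagrams of labelled multigraphs\<close>

text \<open>
  Since the order of the endpoints on a circle is irrelevant, new endpoints can always be placed at
  the base points.
\<close>

definition prepend :: "nat \<Rightarrow> 'a list \<Rightarrow> 'a list list \<Rightarrow> 'a list list" where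
  "prepend i w G = G[i := w @ G ! i]"

lemma length_prepend [simp]: "length (prepend i w G) = length G"
  by (simp add: prepend_def)

lemma nth_prepend: "k < length G \<Longrightarrow> prepend i w G ! k = (if k = i then w @ G ! k else G ! k)"
  by (simp add: prepend_def nth_list_update)

lemma mset_concat_prepend:
  assumes "i < length G"
  shows "mset (concat (prepend i w G)) = mset w + mset (concat G)"
proof -
  have "concat G = concat (take i G) @ G ! i @ concat (drop (Suc i) G)"
    using arg_cong[OF id_take_nth_drop[OF assms], of concat]
    by (simp only: concat_append concat.simps append_assoc)
  moreover have "prepend i w G = take i G @ (w @ G ! i) # drop (Suc i) G"
    unfolding prepend_def by (rule upd_conv_take_nth_drop[OF assms])
  ultimately show ?thesis by (simp only: concat_append concat.simps mset_append) (simp add: ac_simps)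
qed

lemma fill_prepend: "i < length C \<Longrightarrow> fill (prepend i v C) ws = prepend i (plug ws v) (fill C ws)"
  by (simp add: fill_plug prepend_def map_update)

lemma fill_map_Inr [simp]: "fill (map (map Inr) G) ws = G"
  by (simp add: fill_plug comp_def)

lemma mset_holes_prepend:
  assumes "i < length C"
  shows "mset (holes (prepend i v C)) = mset (word_holes v) + mset (holes C)"
proof -
  have "mset (concat (prepend i v C)) = mset (v @ concat C)"
    using mset_concat_prepend[OF assms] by simp
  from mset_word_holes_cong[OF this] show ?thesis by (simp add: holes_word_holes)
qed

lemma loose_prepend:
  assumes "i < length C"
  shows "loose (prepend i v C) = mset (word_loose v) + loose C"
proof -
  have "mset (concat (prepend i v C)) = mset (v @ concat C)"
    using mset_concat_prepend[OF assms] by simp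
  from mset_word_loose_cong[OF this] show ?thesis by (simp add: loose_def)
qed

lemma holes_map_Inr [simp]: "holes (map (map Inr) G) = []"
  by (simp add: holes_word_holes flip: map_concat)

lemma loose_map_Inr [simp]: "loose (map (map Inr) G) = mset (concat G)"
  by (simp add: loose_def flip: map_concat)

text \<open>
  An edge \<open>(c, s, i, j)\<close> stands for the chord \<open>c\<close> of sign \<open>s\<close> from circle \<open>i\<close> to circle \<open>j\<close>.
\<close>

type_synonym edge = "nat \<times> int \<times> nat \<times> nat"

fun draw :: "nat \<Rightarrow> edge list \<Rightarrow> gauss_code" where
  "draw n [] = replicate n []"
| "draw n ((c, s, i, j) # es) = prepend i [Over c s] (prepend j [Under c s] (draw n es))"

definition edges_ok :: "nat \<Rightarrow> edge list \<Rightarrow> bool" where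
  "edges_ok n es \<longleftrightarrow> distinct (map fst es) \<and> (\<forall>(c, s, i, j)\<in>set es. s \<in> {1, -1} \<and> i < n \<and> j < n)"

lemma edges_ok_simps [simp]:
  "edges_ok n []"
  "edges_ok n ((c, s, i, j) # es) \<longleftrightarrow>
     edges_ok n es \<and> c \<notin> fst ` set es \<and> s \<in> {1, -1} \<and> i < n \<and> j < n"
  by (auto simp: edges_ok_def)

lemma edges_ok_perm:
  assumes "mset es = mset es'"
  shows "edges_ok n es \<longleftrightarrow> edges_ok n es'"
proof -
  have "mset (map fst es) = mset (map fst es')" using assms by simp
  then have "distinct (map fst es) \<longleftrightarrow> distinct (map fst es')"
    by (rule mset_eq_imp_distinct_iff)
  then show ?thesis unfolding edges_ok_def mset_eq_setD[OF assms] by simp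
qed

lemma length_draw [simp]: "length (draw n es) = n"
  by (induction n es rule: draw.induct) auto

lemma mset_draw:
  assumes "edges_ok n es"
  shows "mset (concat (draw n es)) = chord_ends (map (\<lambda>(c, s, i, j). (c, s)) es)"
  using assms by (induction n es rule: draw.induct) (auto simp: mset_concat_prepend)

lemma paired_draw:
  assumes "edges_ok n es"
  shows "paired (mset (concat (draw n es)))"
proof -
  have "distinct (map fst (map (\<lambda>(c, s, i, j). (c, s)) es))"
    using assms by (simp add: edges_ok_def comp_def case_prod_unfold)
  moreover have "\<forall>(c, s)\<in>set (map (\<lambda>(c, s, i, j). (c, s)) es). s \<in> {1, -1}"
    using assms by (auto simp: edges_ok_def)
  ultimately have "paired ({#} + chord_ends (map (\<lambda>(c, s, i, j). (c, s)) es))"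
    unfolding paired_chord_ends by auto
  then show ?thesis unfolding mset_draw[OF assms] by simp
qed

lemma chord_draw:
  assumes "edges_ok n es"
  shows "chord ` set_mset (mset (concat (draw n es))) = fst ` set es"
  unfolding mset_draw[OF assms] chord_chord_ends by (simp add: image_image case_prod_unfold)

lemma gauss_diagram_draw: "edges_ok n es \<Longrightarrow> gauss_diagram n (draw n es)"
  using paired_draw by (simp add: gauss_diagram_iff)

lemma mset_draw_nth:
  assumes "k < n"
  shows "mset (draw n es ! k) = (\<Sum>(c, s, i, j)\<leftarrow>es.
    (if k = i then {#Over c s#} else {#}) + (if k = j then {#Under c s#} else {#}))"
  using assms by (induction n es rule: draw.induct) (auto simp: nth_prepend)

lemma draw_perm:
  assumes "edges_ok n es" "mset es = mset es'"
  shows "draw n es \<approx> draw n es'"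
proof (rule vequiv_same_endpoints[OF gauss_diagram_draw[OF assms(1)]])
  show "mset (draw n es ! k) = mset (draw n es' ! k)" if "k < n" for k
  proof -
    have "sum_list (map f es) = sum_list (map f es')" for f :: "edge \<Rightarrow> nat endpoint multiset"
      using sum_mset_sum_list[of "map f es"] sum_mset_sum_list[of "map f es'"]
      unfolding mset_map assms(2) by simp
    then show ?thesis unfolding mset_draw_nth[OF that] .
  qed
qed simp

lemma arcs_prepend2:
  assumes "i < length G" "j < length G"
  defines "C \<equiv> prepend i [Inl 0] (prepend j [Inl 1] (map (map Inr) G))"
  shows "arcs 2 C" "loose C = mset (concat G)"
    "fill C [u, v] = prepend i u (prepend j v G)"
  using assms by (simp_all add: arcs_def mset_holes_prepend loose_prepend fill_prepend
      numeral_2_eq_2 C_def)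

lemma arcs_prepend3:
  assumes "i < length G" "j < length G" "k < length G"
  defines "C \<equiv> prepend i [Inl 0] (prepend j [Inl 1] (prepend k [Inl 2] (map (map Inr) G)))"
  shows "arcs 3 C" "loose C = mset (concat G)"
    "fill C [u, v, w] = prepend i u (prepend j v (prepend k w G))"
  using assms by (simp_all add: arcs_def mset_holes_prepend loose_prepend fill_prepend
      numeral_3_eq_3 numeral_2_eq_2 C_def)

lemma draw_replace_edge:
  assumes "edges_ok n ((c, s, i, j) # es)" "edges_ok n ((d, t, i, j) # es)"
  shows "draw n ((c, s, i, j) # es) \<approx> draw n ((d, t, i, j) # es)"
    and "draw n ((c, s, i, j) # es) \<approx> draw n ((d, t, j, i) # es)"
proof -
  let ?H = "draw n es"
  have ij: "i < length ?H" "j < length ?H" using assms by simp_all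
  note C = arcs_prepend2[OF ij]
  let ?C = "prepend i [Inl 0] (prepend j [Inl 1] (map (map Inr) ?H))"
  have "paired (loose ?C)" using assms C(2) paired_draw by simp
  moreover have "chord ` set_mset (loose ?C) = fst ` set es"
    using assms unfolding C(2) by (simp add: chord_draw del: set_mset_mset)
  moreover have "c \<notin> fst ` set es" "d \<notin> fst ` set es" "s \<in> {1, -1}" "t \<in> {1, -1}"
    using assms by simp_all
  ultimately have *: "fill ?C [[Over c s], [opp (Over c s)]] \<approx> fill ?C [[x], [opp x]]"
    if "x = Over d t \<or> x = Under d t" for x
    using that by (intro vequiv_replace_chord[OF C(1)]) (elim disjE; simp)+
  show "draw n ((c, s, i, j) # es) \<approx> draw n ((d, t, i, j) # es)"
    using *[of "Over d t"] unfolding C(3) by simp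
  have "draw n ((c, s, i, j) # es) \<approx> prepend i [Under d t] (prepend j [Over d t] ?H)"
    using *[of "Under d t"] unfolding C(3) by simp
  also have "\<dots> \<approx> draw n ((d, t, j, i) # es)"
  proof (rule vequiv_sym, rule vequiv_same_endpoints)
    show "gauss_diagram n (draw n ((d, t, j, i) # es))"
      using assms by (intro gauss_diagram_draw) simp
  qed (auto simp: nth_prepend)
  finally show "draw n ((c, s, i, j) # es) \<approx> draw n ((d, t, j, i) # es)" .
qed

lemma draw_loop:
  assumes "edges_ok n ((c, s, i, i) # es)"
  shows "draw n ((c, s, i, i) # es) \<approx> draw n es"
proof -
  let ?H = "draw n es"
  let ?C = "prepend i [Inl 0] (map (map Inr) ?H) :: gauss_context"
  have i: "i < n" using assms by simp
  then have C: "arcs 1 ?C" "loose ?C = mset (concat ?H)" "fill ?C [w] = prepend i w ?H" for w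
    by (simp_all add: arcs_def mset_holes_prepend loose_prepend fill_prepend)
  have "mset (concat (draw n ((c, s, i, i) # es))) = mset (concat ?H) + {#Over c s, Under c s#}"
    using i by (simp add: mset_concat_prepend)
  then have "paired (loose ?C + {#Over c s, opp (Over c s)#})"
    unfolding C(2) using paired_draw[OF assms] by simp
  then have "fill ?C [[]] \<approx> fill ?C [[Over c s, opp (Over c s)]]"
    by (rule vequiv_isolated_chord[OF C(1)])
  moreover have "prepend i [] ?H = ?H" by (simp add: prepend_def)
  moreover have "prepend i [Over c s, Under c s] ?H = draw n ((c, s, i, i) # es)"
    using i by (simp add: prepend_def)
  ultimately show ?thesis using vequiv_sym by (simp add: C(3))
qed

text \<open>
  Once the signs are made opposite, the two chords form a second Reidemeister move.
\<close>

lemma draw_double_edge: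
  assumes "edges_ok n ((c, s, i, j) # (d, t, i, j) # es)"
  shows "draw n ((c, s, i, j) # (d, t, i, j) # es) \<approx> draw n es"
proof -
  let ?H = "draw n es"
  have ij: "i < length ?H" "j < length ?H" using assms by simp_all
  note C = arcs_prepend2[OF ij]
  let ?C = "prepend i [Inl 0] (prepend j [Inl 1] (map (map Inr) ?H))"
  let ?W = "[[Over c (- t), Over d t], [Under c (- t), Under d t]]"
  have ok: "edges_ok n ((c, - t, i, j) # (d, t, i, j) # es)"
    using assms by auto
  have "draw n ((c, s, i, j) # (d, t, i, j) # es) \<approx> draw n ((c, - t, i, j) # (d, t, i, j) # es)"
    using assms ok by (rule draw_replace_edge(1))
  also have "\<dots> \<approx> fill ?C ?W"
    unfolding C(3) by (rule vequiv_same_endpoints[OF gauss_diagram_draw[OF ok]])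
      (auto simp: nth_prepend)
  also have "\<dots> \<approx> fill ?C [[], []]"
  proof (rule vequiv_sym, rule vequiv_pattern[where vs = "[[Inl 0], [Inl 1]]"])
    show "reidemeister_pattern [[], []] ?W \<or> vDelta_pattern [[], []] ?W"
      by (rule disjI1, rule R2_pattern[of "- t" _ c d]) (use assms in auto)
    have "mset (concat ?W) = chord_ends [(c, - t), (d, t)]" by (simp add: add_mset_commute)
    moreover have "chord ` set_mset (loose ?C) = fst ` set es"
      using assms unfolding C(2) by (simp add: chord_draw del: set_mset_mset)
    moreover show "paired (loose ?C + mset (concat [[], []]))"
      using assms C(2) paired_draw by simp
    ultimately show "paired (loose ?C + mset (concat ?W))"
      using assms by (simp add: paired_chord_ends del: chord_ends_simps) auto
  qed (use C(1) in \<open>simp_all add: numeral_2_eq_2\<close>)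
  also have "fill ?C [[], []] = ?H"
    unfolding C(3) by (simp add: prepend_def)
  finally show ?thesis .
qed

text \<open>
  The detour through circle \<open>k\<close>, with its two chords reversed to make them point from \<open>i\<close> to \<open>j\<close>.
\<close>

lemma draw_triangle:
  assumes "edges_ok n ((b, t, i, k) # (d, u, k, j) # es)" "edges_ok n ((c, s, i, j) # es)"
    and "c \<noteq> b" "c \<noteq> d"
  shows "draw n ((c, s, i, j) # es) \<approx> draw n ((b, t, i, k) # (d, u, k, j) # es)"
proof -
  let ?H = "draw n es"
  have ijk: "i < length ?H" "j < length ?H" "k < length ?H" using assms by simp_all
  note C = arcs_prepend3[OF ijk]
  let ?C = "prepend i [Inl 0] (prepend j [Inl 1] (prepend k [Inl 2] (map (map Inr) ?H)))"
  have "chord ` set_mset (loose ?C) = fst ` set es"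
    using assms unfolding C(2) by (simp add: chord_draw del: set_mset_mset)
  then have fresh: "{c, d, b} \<inter> chord ` set_mset (loose ?C) = {}"
    using assms by (simp only: edges_ok_simps) simp
  have paired: "paired (loose ?C)" using assms unfolding C(2) by (simp add: paired_draw)
  have ok: "edges_ok n ((b, t, k, i) # (d, u, j, k) # es)"
    using assms by auto
  have "draw n ((c, s, i, j) # es) = fill ?C [[Over c s], [Under c s], []]"
    unfolding C(3) by (simp add: prepend_def)
  also have "\<dots> \<approx> fill ?C [[Under b t], [Over d u], along 1 (Under d u) (Over b t)]"
    by (rule vequiv_detour[OF C(1) paired fresh]) (use assms in simp_all)
  also have "\<dots> \<approx> draw n ((b, t, k, i) # (d, u, j, k) # es)"
    unfolding C(3)
    by (rule vequiv_sym, rule vequiv_same_endpoints[OF gauss_diagram_draw[OF ok]])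
      (auto simp: nth_prepend along_def)
  also have "\<dots> \<approx> draw n ((b, t, i, k) # (d, u, j, k) # es)"
    by (rule draw_replace_edge(2)) (use ok assms in auto)
  also have "\<dots> \<approx> draw n ((d, u, j, k) # (b, t, i, k) # es)"
    by (rule draw_perm) (use ok assms in \<open>auto simp: add_mset_commute\<close>)
  also have "\<dots> \<approx> draw n ((d, u, k, j) # (b, t, i, k) # es)"
    by (rule draw_replace_edge(2)) (use ok assms in auto)
  also have "\<dots> \<approx> draw n ((b, t, i, k) # (d, u, k, j) # es)"
    by (rule draw_perm) (use ok assms in \<open>auto simp: add_mset_commute\<close>)
  finally show ?thesis .
qed

lemma remove_endpoint:
  assumes "x \<in># mset (concat G)"
  obtains i H where "i < length G" "length H = length G"
    "\<And>k. k < length G \<Longrightarrow> mset (G ! k) = mset (prepend i [x] H ! k)"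
proof -
  obtain w where "w \<in> set G" "x \<in> set w" using assms by auto
  then obtain i where i: "i < length G" "x \<in> set (G ! i)" by (metis in_set_conv_nth)
  show thesis
    by (rule that[of i "G[i := remove1 x (G ! i)]"])
      (use i in \<open>auto simp: prepend_def nth_list_update\<close>)
qed

lemma mset_concat_nth_cong:
  assumes "length G = length H" "\<And>k. k < length G \<Longrightarrow> mset (G ! k) = mset (H ! k)"
  shows "mset (concat G) = mset (concat H)"
  using assms
proof (induction G H rule: list_induct2)
  case (Cons u G v H)
  then have "mset u = mset v" "\<And>k. k < length G \<Longrightarrow> mset (G ! k) = mset (H ! k)"
    by fastforce+
  then show ?case using Cons.IH by simp
qed simp

text \<open>
  The edges are read off by removing one chord after the other; the positions of the endpoints that
  are lost in this way do not matter by \<open>vequiv_same_endpoints\<close>.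
\<close>

lemma draw_exists:
  assumes "gauss_diagram n G"
  obtains es where "edges_ok n es" "G \<approx> draw n es"
proof -
  have "\<exists>es. edges_ok n es \<and> (\<forall>k<n. mset (G ! k) = mset (draw n es ! k))"
    using assms
  proof (induction "length (concat G)" arbitrary: G rule: less_induct)
    case less
    have len: "length G = n" and pair: "paired (mset (concat G))"
      using less.prems by (simp_all add: gauss_diagram_iff)
    show ?case
    proof (cases "concat G = []")
      case True
      then have "G ! k = []" if "k < n" for k using that len by simp
      then show ?thesis by (intro exI[of _ "[]"]) simp
    next
      case False
      then obtain e where e: "e \<in># mset (concat G)" by (metis list.set_intros(1) list.exhaust set_mset_mset)
      define c s where "c = chord e" and "s = chord_sign e"
      have "e = Over c s \<or> e = Under c s" unfolding c_def s_def by (cases e) auto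
      then have ends: "Over c s \<in># mset (concat G)" "Under c s \<in># mset (concat G)"
        using e paired_opp[OF pair e] by auto
      obtain i G1 where G1: "i < n" "length G1 = n"
        "\<And>k. k < n \<Longrightarrow> mset (G ! k) = mset (prepend i [Over c s] G1 ! k)"
        using remove_endpoint[OF ends(1)] len by metis
      have c1: "mset (concat G) = {#Over c s#} + mset (concat G1)"
        using mset_concat_nth_cong[of G "prepend i [Over c s] G1"] G1 len
        by (simp add: mset_concat_prepend)
      then have "Under c s \<in># mset (concat G1)" using ends(2) by simp
      then obtain j G0 where G0: "j < n" "length G0 = n"
        "\<And>k. k < n \<Longrightarrow> mset (G1 ! k) = mset (prepend j [Under c s] G0 ! k)"
        using remove_endpoint[of "Under c s" G1] G1(2) by metis
      have "mset (concat G1) = {#Under c s#} + mset (concat G0)"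
        using mset_concat_nth_cong[of G1 "prepend j [Under c s] G0"] G0 G1(2)
        by (simp add: mset_concat_prepend)
      then have c0: "mset (concat G) = mset (concat G0) + chord_ends [(c, s)]"
        using c1 by simp
      then have p0: "paired (mset (concat G0))" "c \<notin> chord ` set_mset (mset (concat G0))" "s \<in> {1, -1}"
        using pair[unfolded c0 paired_chord_ends] by simp_all
      have "size (mset (concat G0)) < size (mset (concat G))" unfolding c0 by simp
      then have "length (concat G0) < length (concat G)" by (simp only: size_mset)
      then obtain es where es: "edges_ok n es" "\<forall>k<n. mset (G0 ! k) = mset (draw n es ! k)"
        using less.hyps[of G0] p0(1) G0(2) by (auto simp: gauss_diagram_iff)
      have G0_es: "mset (concat G0) = mset (concat (draw n es))"
        using es G0(2) by (intro mset_concat_nth_cong) auto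
      have "c \<notin> fst ` set es"
        using p0(2) unfolding G0_es chord_draw[OF es(1)] .
      then have "edges_ok n ((c, s, i, j) # es)" using es p0 G0 G1 by simp
      moreover have "mset (G ! k) = mset (draw n ((c, s, i, j) # es) ! k)" if "k < n" for k
        using that G0 G1 es by (auto simp: nth_prepend)
      ultimately show ?thesis by blast
    qed
  qed
  then show thesis
    using that vequiv_same_endpoints[OF assms] by (metis length_draw)
qed


section \<open>Star diagrams\<close>

text \<open>
  The labels are shifted by \<open>m\<close> to keep them apart from the labels of the diagram that is being
  reduced.
\<close>

definition star :: "nat \<Rightarrow> nat list \<Rightarrow> edge list" where
  "star m T = map (\<lambda>i. (m + i, 1, 0, i)) T"

lemma star_simps [simp]:
  "star m [] = []" "star m (i # T) = (m + i, 1, 0, i) # star m T"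
  by (simp_all add: star_def)

lemma edges_ok_append:
  "edges_ok n (es @ es') \<longleftrightarrow>
     edges_ok n es \<and> edges_ok n es' \<and> fst ` set es \<inter> fst ` set es' = {}"
  unfolding edges_ok_def map_append distinct_append set_append ball_Un set_map by argo

lemma star_labels: "fst ` set (star m T) = (+) m ` set T"
  by (induction T) auto

lemma edges_ok_star: "edges_ok n (star m T) \<longleftrightarrow> distinct T \<and> (\<forall>i\<in>set T. i < n) \<and> (T = [] \<or> 0 < n)"
  by (induction T) (auto simp: star_labels simp del: set_map)

text \<open>
  An edge from circle \<open>0\<close> to circle \<open>i\<close> is deleted if it is a loop, cancels against the edge of the
  star at \<open>i\<close> if there is one, and otherwise becomes a new edge of the star.
\<close>

lemma star_absorb:
  assumes ok: "edges_ok n ((c, s, 0, i) # es @ star m T)"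
    and T: "0 \<notin> set T"
    and labels: "c \<notin> {m..<m + n}" "fst ` set es \<inter> {m..<m + n} = {}"
  obtains T' where "0 \<notin> set T'" "edges_ok n (star m T')"
    "draw n ((c, s, 0, i) # es @ star m T) \<approx> draw n (es @ star m T')"
proof -
  consider "i = 0" | "i \<in> set T" | "i \<noteq> 0" "i \<notin> set T" by blast
  then show thesis
  proof cases
    case 1
    then show thesis using ok T draw_loop by (intro that[of T]) (auto simp: edges_ok_append)
  next
    case 2
    define U where "U = remove1 i T"
    have TU: "mset T = mset (i # U)" using 2 by (simp add: U_def)
    then have perm: "mset ((c, s, 0, i) # es @ star m T) =
        mset ((c, s, 0, i) # (m + i, 1, 0, i) # es @ star m U)"
      by (simp add: star_def)
    have ok': "edges_ok n ((c, s, 0, i) # (m + i, 1, 0, i) # es @ star m U)"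
      using ok edges_ok_perm[OF perm] by blast
    have "draw n ((c, s, 0, i) # es @ star m T) \<approx>
        draw n ((c, s, 0, i) # (m + i, 1, 0, i) # es @ star m U)"
      using ok perm by (rule draw_perm)
    also have "\<dots> \<approx> draw n (es @ star m U)" using ok' by (rule draw_double_edge)
    finally have "draw n ((c, s, 0, i) # es @ star m T) \<approx> draw n (es @ star m U)" .
    moreover have "0 \<notin> set U" using T unfolding U_def using notin_set_remove1 by fast
    ultimately show thesis using ok' by (intro that[of U]) (auto simp: edges_ok_append)
  next
    case 3
    have "i < n" using ok by simp
    then have "m + i \<notin> fst ` set es" using labels(2) by auto
    moreover have "m + i \<notin> fst ` set (star m T)" using 3 by (auto simp: star_labels)
    ultimately have ok': "edges_ok n ((m + i, 1, 0, i) # es @ star m T)"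
      using ok by (auto simp: image_Un)
    have perm: "mset ((m + i, 1, 0, i) # es @ star m T) = mset (es @ star m (i # T))"
      by simp
    have "draw n ((c, s, 0, i) # es @ star m T) \<approx> draw n ((m + i, 1, 0, i) # es @ star m T)"
      using ok ok' by (rule draw_replace_edge(1))
    also have "\<dots> \<approx> draw n (es @ star m (i # T))"
      using ok' perm by (rule draw_perm)
    finally have "draw n ((c, s, 0, i) # es @ star m T) \<approx> draw n (es @ star m (i # T))" .
    moreover have "edges_ok n (es @ star m (i # T))"
      using ok' edges_ok_perm[OF perm] by blast
    ultimately show thesis using 3 T by (intro that[of "i # T"]) (auto simp: edges_ok_append)
  qed
qed

text \<open>
  Each edge is routed through circle \<open>0\<close>, and the star absorbs the two resulting edges.
\<close>

lemma draw_star: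
  assumes "edges_ok n (es @ star m T)" "0 \<notin> set T" "fst ` set es \<inter> {m..<m + n} = {}"
  shows "\<exists>T'. 0 \<notin> set T' \<and> edges_ok n (star m T') \<and> draw n (es @ star m T) \<approx> draw n (star m T')"
  using assms
proof (induction es arbitrary: T)
  case Nil
  then show ?case by auto
next
  case (Cons e es)
  obtain c s i j where e: "e = (c, s, i, j)" by (cases e)
  have ok: "edges_ok n ((c, s, i, j) # es @ star m T)" using Cons.prems by (simp add: e)
  \<comment> \<open>The new labels avoid \<open>{m..<m + n}\<close>, the labels that the star may use later on.\<close>
  let ?F = "insert c (fst ` set (es @ star m T)) \<union> {m..<m + n}"
  obtain b where b: "b \<notin> ?F" using fresh_label[of ?F] by blast
  obtain d where d: "d \<notin> insert b ?F" using fresh_label[of "insert b ?F"] by blast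
  have ok2: "edges_ok n ((b, 1, 0, i) # ((d, 1, 0, j) # es) @ star m T)"
    using ok b d by auto
  have "draw n (e # es @ star m T) \<approx> draw n ((b, 1, i, 0) # (d, 1, 0, j) # es @ star m T)"
    unfolding e by (rule draw_triangle) (use ok ok2 b d in auto)
  also have "\<dots> \<approx> draw n ((b, 1, 0, i) # ((d, 1, 0, j) # es) @ star m T)"
    using draw_replace_edge(2)[of n b 1 i 0 "((d, 1, 0, j) # es) @ star m T" b 1] ok2 by auto
  finally have 1: "draw n (e # es @ star m T) \<approx> draw n ((b, 1, 0, i) # ((d, 1, 0, j) # es) @ star m T)" .
  obtain T1 where T1: "0 \<notin> set T1" "edges_ok n (star m T1)"
    "draw n ((b, 1, 0, i) # ((d, 1, 0, j) # es) @ star m T) \<approx> draw n (((d, 1, 0, j) # es) @ star m T1)"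
    using star_absorb[OF ok2 Cons.prems(2)] b d Cons.prems(3) by (auto simp: e)
  have sub: "fst ` set (star m T1) \<subseteq> {m..<m + n}"
    using T1(2) by (auto simp: star_labels edges_ok_star)
  have labels: "d \<notin> {m..<m + n}" "fst ` set es \<inter> {m..<m + n} = {}"
    using d Cons.prems(3) by (auto simp: e)
  have ok3: "edges_ok n ((d, 1, 0, j) # es @ star m T1)"
    using ok2 T1(2) sub labels by (auto simp: edges_ok_append image_Un)
  obtain T2 where T2: "0 \<notin> set T2" "edges_ok n (star m T2)"
    "draw n ((d, 1, 0, j) # es @ star m T1) \<approx> draw n (es @ star m T2)"
    using star_absorb[OF ok3 T1(1) labels] by blast
  have "edges_ok n (es @ star m T2)"
  proof -
    have "fst ` set (star m T2) \<subseteq> {m..<m + n}"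
      using T2(2) by (auto simp: star_labels edges_ok_star)
    then show ?thesis using ok3 T2(2) labels by (auto simp: edges_ok_append)
  qed
  from Cons.IH[OF this T2(1) labels(2)] obtain T3 where
    "0 \<notin> set T3" "edges_ok n (star m T3)" "draw n (es @ star m T2) \<approx> draw n (star m T3)"
    by blast
  then show ?case using 1 T1(3) T2(3) vequiv_trans by (metis append_Cons)
qed

lemma length_draw_star:
  assumes "i < n" "i \<noteq> 0"
  shows "length (draw n (star m T) ! i) = count (mset T) i"
  using assms by (induction T) (auto simp: nth_prepend)


section \<open>Invariance of the parities\<close>

lemma vDelta_step_parity:
  assumes "vDelta_step G G'" "i < length G"
  shows "length G' = length G \<and> (even (length (G' ! i)) \<longleftrightarrow> even (length (G ! i)))"
  using assms(1) unfolding vDelta_step_def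
proof
  assume "reidemeister_step G G'"
  then show ?thesis using assms(2) by (rule reidemeister_step_parity)
next
  assume "local_move vDelta_pattern G G'"
  then show ?thesis
  proof (rule local_move_parity[OF _ _ assms(2)])
    show "list_all2 (\<lambda>u v. even (length u) \<longleftrightarrow> even (length v)) as bs"
      if "vDelta_pattern as bs" for as bs
      using that by (auto elim!: vDelta_pattern.cases)
  qed
qed

lemma vDelta_step_length:
  assumes "vDelta_step G G'"
  shows "length G' = length G"
  using assms unfolding vDelta_step_def
proof
  assume "reidemeister_step G G'"
  from reidemeister_step_length[OF this] show ?thesis by (rule sym)
next
  assume "local_move vDelta_pattern G G'"
  then obtain C as bs where "G = fill C as" "G' = fill C bs"
    unfolding local_move_def by blast
  then show ?thesis by (simp add: fill_def)
qed

lemma vequiv_parity: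
  assumes "G \<approx> G'"
  shows "length G' = length G \<and> (\<forall>i<length G. even (length (G' ! i)) \<longleftrightarrow> even (length (G ! i)))"
  using assms
proof (induction rule: equivclp_induct)
  case (step G' G'')
  then have "length G'' = length G'" using vDelta_step_length by metis
  with step show ?case using vDelta_step_parity by metis
qed simp

text \<open>
  Both diagrams reduce to stars with the same shift \<open>m\<close>, and the edge set of a star is visible in
  the parities of the circles other than circle \<open>0\<close>.
\<close>

lemma same_parity_vequiv:
  assumes G: "gauss_diagram n G" and G': "gauss_diagram n G'"
    and parity: "\<And>i. i < n \<Longrightarrow> even (length (G ! i)) \<longleftrightarrow> even (length (G' ! i))"
  shows "G \<approx> G'"
proof -
  obtain es where es: "edges_ok n es" "G \<approx> draw n es" by (rule draw_exists[OF G])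
  obtain es' where es': "edges_ok n es'" "G' \<approx> draw n es'" by (rule draw_exists[OF G'])
  define m where "m = Suc (Max (insert 0 (fst ` set (es @ es'))))"
  have m: "c < m" if "c \<in> fst ` set (es @ es')" for c
    unfolding m_def using that by (intro le_imp_less_Suc Max_ge) auto
  have star: "\<exists>T. 0 \<notin> set T \<and> edges_ok n (star m T) \<and> draw n fs \<approx> draw n (star m T)"
    if "edges_ok n fs" "fst ` set fs \<subseteq> fst ` set (es @ es')" for fs
  proof -
    have "fst ` set fs \<inter> {m..<m + n} = {}"
      using m that(2) by (meson atLeastLessThan_iff disjoint_iff leD subsetD)
    then show ?thesis using draw_star[of n fs m "[]"] that(1) by simp
  qed
  obtain T where T: "0 \<notin> set T" "edges_ok n (star m T)" "draw n es \<approx> draw n (star m T)"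
    using star[OF es(1)] by auto
  obtain T' where T': "0 \<notin> set T'" "edges_ok n (star m T')" "draw n es' \<approx> draw n (star m T')"
    using star[OF es'(1)] by auto
  note GT = vequiv_trans[OF es(2) T(3)]
  note GT' = vequiv_trans[OF es'(2) T'(3)]
  have len: "length G = n" "length G' = n" using G G' by (simp_all add: gauss_diagram_def)
  have distinct: "distinct T" "distinct T'" using T(2) T'(2) by (simp_all add: edges_ok_star)
  have "i \<in> set T \<longleftrightarrow> i \<in> set T'" for i
  proof (cases "i \<noteq> 0 \<and> i < n")
    case True
    have "even (count (mset T) i) \<longleftrightarrow> even (count (mset T') i)"
      using vequiv_parity[OF GT] vequiv_parity[OF GT'] parity[of i] len True
        length_draw_star[of i n m T] length_draw_star[of i n m T'] by metis
    moreover have "count (mset U) i = (if i \<in> set U then 1 else 0)" if "distinct U" for U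
      using that unfolding distinct_count_atmost_1 by blast
    ultimately show ?thesis using distinct by (simp split: if_splits)
  next
    case False
    then show ?thesis using T T' by (auto simp: edges_ok_star)
  qed
  then have "set T = set T'" by blast
  then have "mset T = mset T'" using distinct set_eq_iff_mset_eq_distinct by blast
  then have "mset (star m T) = mset (star m T')" by (simp add: star_def)
  then have "draw n (star m T) \<approx> draw n (star m T')" using T(2) by (intro draw_perm)
  from vequiv_trans[OF vequiv_trans[OF GT this] vequiv_sym[OF GT']] show ?thesis .
qed

lemma virtual_links_nonempty:
  assumes "L \<in> virtual_links n"
  obtains G where "G \<in> L"
proof -
  obtain H where H: "gauss_diagram n H"
    "L = {G. gauss_diagram n G \<and> equivclp reidemeister_step H G}"
    using assms unfolding virtual_links_def quotient_def by auto
  then have "H \<in> L" by simp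
  then show thesis by (rule that)
qed

lemma virtual_links_diagram: "L \<in> virtual_links n \<Longrightarrow> G \<in> L \<Longrightarrow> gauss_diagram n G"
  unfolding virtual_links_def quotient_def by auto

theorem theorem1p5:
  fixes n :: nat and L L' :: "gauss_code set"
  assumes "n \<ge> 2"
    and "L \<in> virtual_links n" and "L' \<in> virtual_links n"
  shows "vDelta_equivalent L L' \<longleftrightarrow> (\<forall>i<n. link_parity L i = link_parity L' i)"
proof -
  have parity: "link_parity K i = length (G ! i) mod 2"
    if "K \<in> virtual_links n" "G \<in> K" "i < n" for K G i
    using that link_parity_eq diagram_parity_length virtual_links_diagram by metis
  show ?thesis
  proof
    assume "vDelta_equivalent L L'"
    then obtain G G' where G: "G \<in> L" "G' \<in> L'" "G \<approx> G'"
      unfolding vDelta_equivalent_def by blast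
    have "length G = n"
      using virtual_links_diagram[OF assms(2) G(1)] by (simp add: gauss_diagram_def)
    with vequiv_parity[OF G(3)] show "\<forall>i<n. link_parity L i = link_parity L' i"
      using parity[OF assms(2) G(1)] parity[OF assms(3) G(2)] by (simp add: mod2_eq_if)
  next
    assume *: "\<forall>i<n. link_parity L i = link_parity L' i"
    obtain G G' where G: "G \<in> L" "G' \<in> L'"
      using virtual_links_nonempty[OF assms(2)] virtual_links_nonempty[OF assms(3)] by metis
    have "G \<approx> G'"
    proof (rule same_parity_vequiv)
      show "gauss_diagram n G" "gauss_diagram n G'"
        using G virtual_links_diagram assms by blast+
      show "even (length (G ! i)) \<longleftrightarrow> even (length (G' ! i))" if "i < n" for i
        using * that parity[OF assms(2) G(1) that] parity[OF assms(3) G(2) that]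
        by (metis even_iff_mod_2_eq_zero)
    qed
    then show "vDelta_equivalent L L'" unfolding vDelta_equivalent_def using G by blast
  qed
qed

end
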